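(* Let $L>0$ and let $m,n$ be continuous functions on $[0,L]$, bounded below by some positive constant. Suppose that, for some $\gamma>1$, the function $\big(m^{-\frac12}+(nt)^{-\frac12}\big)^{-1}$ satisfies the $\gamma$-condition for every $t>0$. Then for each fixed $t>0$ and for all $\delta\in[\frac1\gamma,1]$, $$N(\lambda,t,(0,L))=\frac{4\sqrt\lambda}{\pi}\int_0^L\big(m^{-\frac12}+(nt)^{-\frac12}\big)^{-1}dx+O(\lambda^{\delta/2})\qquad\text{as }\lambda\to\infty.$$
   Context: For a function $u$, $u^\pm=\max\{0,\pm u\}$. For $t>0$, consider the eigenvalue problem $$-u''=\lambda\big(m(x)u^+-t\,n(x)u^-\big)\ \text{ in }(0,L),\qquad u(0)=u(L)=0.$$ Its spectrum is a double sequence $\{\lambda_{k,t}^\pm\}_{k\ge1}$, where for each $k\ge 1$, $\lambda_{k,t}^+$ (resp. $\lambda_{k,t}^-$) is the unique $\lambda>0$ for which the problem has a nontrivial solution with exactly $k$ nodal domains in $(0,L)$ (i.e. $k+1$ zeros in $[0,L]$) and $u'(0)>0$ (resp. $u'(0)<0$). The spectral counting function is $$N(\lambda,t,(0,L))=\#\{k:\lambda_{k,t}^+\le\lambda\}+\#\{k:\lambda_{k,t}^-\le\lambda\}.$$ Given $\gamma>0$, a function $h$ on $[0,L]$ satisfies the $\gamma$-condition if $h$ is continuous, there exist constants $0<h_1\le h\le h_2<\infty$, and there is a constant $C$ such that $$\int_I|h-h_I|\,dx\le C|I|^\gamma$$ for every interval $I\subset(0,L)$, where $h_I=\frac1{|I|}\int_I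 h(x)\,dx$. *)

theory Defs
  imports "HOL-Analysis.Analysis" "HOL-Library.Landau_Symbols"
begin

definition pos_part :: "(real \<Rightarrow> real) \<Rightarrow> real \<Rightarrow> real" where
  "pos_part u x = max 0 (u x)"

definition neg_part :: "(real \<Rightarrow> real) \<Rightarrow> real \<Rightarrow> real" where
  "neg_part u x = max 0 (- u x)"

text \<open>Classical solutions: \<open>u\<close> is continuously differentiable on \<open>[0,L]\<close> with derivative \<open>u'\<close>
  (one-sided at the end points, so that \<open>u'(0)\<close> makes sense), and the equation holds pointwise
  in \<open>(0,L)\<close>. The values of \<open>u\<close>, \<open>u'\<close>, \<open>m\<close>, \<open>n\<close> outside \<open>[0,L]\<close> are irrelevant.\<close>

definition solves_problem ::
  "(real \<Rightarrow> real) \<Rightarrow> (real \<Rightarrow> real) \<Rightarrow> real \<Rightarrow> real \<Rightarrow> real \<Rightarrow> (real \<Rightarrow> real) \<Rightarrow> (real \<Rightarrow> real) \<Rightarrow> bool"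
  where
  "solves_problem m n t L lam u u' \<longleftrightarrow>
     (\<forall>x\<in>{0..L}. (u has_real_derivative u' x) (at x within {0..L})) \<and>
     continuous_on {0..L} u' \<and>
     (\<forall>x\<in>{0<..<L}. (u' has_real_derivative
        - (lam * (m x * pos_part u x - t * n x * neg_part u x))) (at x)) \<and>
     u 0 = 0 \<and> u L = 0"

definition nodal_domains :: "real \<Rightarrow> (real \<Rightarrow> real) \<Rightarrow> real set set" where
  "nodal_domains L u = components {x \<in> {0<..<L}. u x \<noteq> 0}"

text \<open>The two sequences are only meaningful for \<open>k \<ge> 1\<close>.\<close>

definition eigenvalue_plus ::
  "(real \<Rightarrow> real) \<Rightarrow> (real \<Rightarrow> real) \<Rightarrow> real \<Rightarrow> real \<Rightarrow> nat \<Rightarrow> real" where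
  "eigenvalue_plus m n t L k =
     (THE lam. lam > 0 \<and> (\<exists>u u'. solves_problem m n t L lam u u' \<and> (\<exists>x\<in>{0..L}. u x \<noteq> 0) \<and>
        card (nodal_domains L u) = k \<and> u' 0 > 0))"

definition eigenvalue_minus ::
  "(real \<Rightarrow> real) \<Rightarrow> (real \<Rightarrow> real) \<Rightarrow> real \<Rightarrow> real \<Rightarrow> nat \<Rightarrow> real" where
  "eigenvalue_minus m n t L k =
     (THE lam. lam > 0 \<and> (\<exists>u u'. solves_problem m n t L lam u u' \<and> (\<exists>x\<in>{0..L}. u x \<noteq> 0) \<and>
        card (nodal_domains L u) = k \<and> u' 0 < 0))"

definition counting_function ::
  "(real \<Rightarrow> real) \<Rightarrow> (real \<Rightarrow> real) \<Rightarrow> real \<Rightarrow> real \<Rightarrow> real \<Rightarrow> nat" where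
  "counting_function m n lam t L =
     card {k. k \<ge> 1 \<and> eigenvalue_plus m n t L k \<le> lam} +
     card {k. k \<ge> 1 \<and> eigenvalue_minus m n t L k \<le> lam}"

definition average :: "real \<Rightarrow> real \<Rightarrow> (real \<Rightarrow> real) \<Rightarrow> real" where
  "average a b h = 1 / (b - a) * integral {a<..<b} h"

text \<open>It suffices to quantify over nondegenerate open intervals, since including end points
  changes neither the integrals nor the length.\<close>

definition gamma_condition :: "real \<Rightarrow> real \<Rightarrow> (real \<Rightarrow> real) \<Rightarrow> bool" where
  "gamma_condition \<gamma> L h \<longleftrightarrow>
     continuous_on {0..L} h \<and>
     (\<exists>h1 h2. 0 < h1 \<and> (\<forall>x\<in>{0..L}. h1 \<le> h x \<and> h x \<le> h2)) \<and>
     (\<exists>C. \<forall>a b. a < b \<and> {a<..<b} \<subseteq> {0<..<L} \<longrightarrow>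
        integral {a<..<b} (\<lambda>x. \<bar>h x - average a b h\<bar>) \<le> C * (b - a) powr \<gamma>)"

definition harmonic_weight ::
  "(real \<Rightarrow> real) \<Rightarrow> (real \<Rightarrow> real) \<Rightarrow> real \<Rightarrow> real \<Rightarrow> real" where
  "harmonic_weight m n t x = inverse (m x powr (- 1 / 2) + (n x * t) powr (- 1 / 2))"

end

theory Submission
  imports Defs
begin

text \<open>Write \<open>p = m\<close>, \<open>q = t n\<close>, \<open>\<mu> = sqrt \<lambda>\<close> and
\<open>H = 1 / (1 / sqrt p + 1 / sqrt q)\<close>, which is the harmonic weight. The proof
counts zeros with a Pruefer angle. Setting \<open>u = r sin y\<close>, \<open>u' = r cos y\<close> turns the equation into the scalar
equation \<open>y' = (cos y)\<^sup>2 + \<lambda> (p (sin y)\<^sub>+\<^sup>2 + q (sin y)\<^sub>-\<^sup>2)\<close>, and \<open>u\<close> vanishes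
exactly where \<open>y\<close> is a multiple of \<open>\<pi>\<close>. With \<open>y(0) = 0\<close> the angle is strictly increasing in \<open>x\<close>;
its end value \<open>y(L)\<close> is continuous and strictly increasing in \<open>\<lambda>\<close>, below \<open>\<pi>\<close> for \<open>\<lambda> = 0\<close> and unbounded.
Together with uniqueness for the initial value problem and positive homogeneity, this shows that
\<open>\<lambda>\<^sub>k\<^sup>+\<close> is the one parameter with \<open>y(L) = k \<pi>\<close>, so that the number of
\<open>\<lambda>\<^sub>k\<^sup>+ \<le> \<lambda>\<close> is the integer part of \<open>y(L) / \<pi>\<close> (\<open>angle_attains\<close>,
\<open>eigenvalue_condition_iff\<close>, \<open>card_eigenvalue_plus_le\<close>). Since \<open>-u\<close> solves the problem with the two weights
exchanged, the sequence \<open>\<lambda>\<^sub>k\<^sup>-\<close> is covered by the same result (\<open>eigenvalue_minus_swap\<close>). It remains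
to show that \<open>y(L) = 2 \<mu> \<integral> H + O(\<mu> powr (1 / \<gamma>))\<close>, because \<open>H\<close> is symmetric in \<open>p\<close> and \<open>q\<close>.

If the weights are constant, the angle equation is integrated by the phase
\<open>\<Psi>(y) = \<integral> dy / ((cos y)\<^sup>2 + \<lambda> (p (sin y)\<^sub>+\<^sup>2 + q (sin y)\<^sub>-\<^sup>2))\<close>, for which \<open>\<Psi>(y(x)) - x\<close> is
constant. \<open>\<Psi>\<close> stays within a bounded number of periods of the linear function of slope \<open>\<kappa> = 1 / (2 \<mu> H)\<close>
(\<open>two_sided_phase\<close>), so over an interval the angle grows by \<open>2 \<mu> H\<close> times its length, up to \<open>O(1)\<close>.
If the weights vary over an interval \<open>I\<close>, the same computation with the weights frozen at a point \<open>\<xi>\<close> of \<open>I\<close>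
costs an additional \<open>O(\<mu> \<integral>\<^sub>I (|p - p(\<xi>)| + |q - q(\<xi>)|))\<close> (\<open>angle_increment_frozen\<close>).

The \<open>\<gamma>\<close>-condition bounds this integral. The functions \<open>1 / sqrt p\<close> and \<open>1 / sqrt q\<close> are linear combinations of the reciprocals of the harmonic weights for \<open>t\<close> and \<open>4 t\<close>,
so all the oscillations are controlled by those of two functions with the \<open>\<gamma>\<close>-condition, and a point \<open>\<xi>\<close> where
both are close to their averages gives the bound \<open>B |I| powr \<gamma>\<close>
(\<open>mean_oscillation_bound_from_gamma_condition\<close>). Cutting \<open>[0,L]\<close> into \<open>M\<close> equal pieces, the total error is
\<open>O(M) + O(\<mu> M powr (1 - \<gamma>))\<close>; for \<open>M\<close> of order \<open>\<mu> powr (1 / \<gamma>)\<close> both terms are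
of this order (\<open>angle_asymptotics\<close>).\<close>

section \<open>Ordinary differential equations\<close>

text \<open>Differentiating \<open>exp (- K x) f x - e x\<close> shows that this function decreases. The derivative is
assumed in the open interval only, which is where the eigenvalue equation holds.\<close>

lemma gronwall_inequality:
  fixes f f' :: "real \<Rightarrow> real"
  assumes cont: "continuous_on {0..L} f"
    and der: "\<And>x. x \<in> {0<..<L} \<Longrightarrow> (f has_real_derivative f' x) (at x)"
    and le: "\<And>x. x \<in> {0<..<L} \<Longrightarrow> f' x \<le> K * f x + e"
    and "f 0 \<le> 0" "0 \<le> K" "0 \<le> e" and x: "x \<in> {0..L}"
  shows "f x \<le> e * x * exp (K * x)"
proof -
  let ?g = "\<lambda>x. exp (- K * x) * f x - e * x"
  have "?g x \<le> ?g 0"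
  proof (rule DERIV_nonpos_imp_decreasing_open[where f = ?g])
    show "continuous_on {0..x} ?g"
      using x by (intro continuous_intros continuous_on_subset[OF cont]) auto
    fix z assume z: "0 < z" "z < x"
    then have zL: "z \<in> {0<..<L}" using x by auto
    have "exp (- K * z) * (f' z - K * f z) \<le> exp (- K * z) * e"
      using le[OF zL] by (intro mult_left_mono) auto
    also have "\<dots> \<le> 1 * e"
      using z assms by (intro mult_right_mono) auto
    finally have "exp (- K * z) * (f' z - K * f z) - e \<le> 0" by simp
    moreover have "(?g has_real_derivative exp (- K * z) * (f' z - K * f z) - e) (at z)"
      using der[OF zL] by (auto intro!: derivative_eq_intros simp: algebra_simps)
    ultimately show "\<exists>y. (?g has_real_derivative y) (at z) \<and> y \<le> 0" by blast
  qed (use x in auto)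
  then have "exp (- K * x) * f x \<le> e * x" using assms by simp
  then have "exp (K * x) * (exp (- K * x) * f x) \<le> exp (K * x) * (e * x)"
    by (intro mult_left_mono) auto
  then show ?thesis by (simp add: mult.assoc[symmetric] exp_add[symmetric]) (simp add: algebra_simps)
qed

text \<open>One application of Banach's fixed point theorem gives the solution on the whole interval: measuring
\<open>exp (- 2 k x) y x\<close> in the supremum norm instead of \<open>y x\<close> makes the integral operator a contraction,
whatever the length of the interval is.\<close>

lemma picard_lindelof:
  fixes F :: "real \<Rightarrow> 'a \<Rightarrow> 'a::banach"
  assumes "0 \<le> L" and cont: "continuous_on ({0..L} \<times> UNIV) (\<lambda>z. F (fst z) (snd z))"
    and lip: "\<And>x y z. x \<in> {0..L} \<Longrightarrow> norm (F x y - F x z) \<le> K * norm (y - z)"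
  shows "\<exists>y. y 0 = y0 \<and>
    (\<forall>x\<in>{0..L}. (y has_vector_derivative F x (y x)) (at x within {0..L}))"
proof -
  \<comment> \<open>Composing with \<open>c\<close> extends a function on \<open>[0,L]\<close> to a bounded continuous one on the line.\<close>
  define c where "c x = max 0 (min L x)" for x
  have c: "c x \<in> {0..L}" for x using \<open>0 \<le> L\<close> by (auto simp: c_def)
  have c_id: "c x = x" if "x \<in> {0..L}" for x using that by (auto simp: c_def)
  have c_cont: "continuous_on UNIV c" unfolding c_def by (intro continuous_intros)
  define k where "k = max 1 K"
  have k: "0 < k" "K \<le> k" by (auto simp: k_def)
  \<comment> \<open>\<open>T\<close> is the Picard operator written in terms of \<open>v x = exp (- 2 k x) y x\<close>.\<close>
  define G where "G v s = F s (exp (2 * k * s) *\<^sub>R v s)" for v s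
  have Gc: "continuous_on {0..L} (G v)" if "continuous_on {0..L} v" for v
    unfolding G_def
    by (rule continuous_on_compose2[OF cont, of _ "\<lambda>s. (s, exp (2 * k * s) *\<^sub>R v s)", simplified])
       (auto intro!: continuous_intros that)
  define T where "T v x = exp (- 2 * k * x) *\<^sub>R (y0 + integral {0..x} (G v))" for v x
  have Tc: "continuous_on {0..L} (T v)" if "continuous_on {0..L} v" for v
    unfolding T_def
    by (intro continuous_intros indefinite_integral_continuous_1 integrable_continuous_interval Gc that)
  have TB: "(\<lambda>x. T v (c x)) \<in> bcontfun" if "continuous_on {0..L} v" for v
  proof -
    have "continuous_on UNIV (\<lambda>x. T v (c x))"
      by (rule continuous_on_compose2[OF Tc[OF that] c_cont]) (use c in auto)
    moreover have "bounded (range (\<lambda>x. T v (c x)))"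
      by (rule bounded_subset[OF compact_imp_bounded[OF compact_continuous_image[OF Tc[OF that]]]])
         (use c in auto)
    ultimately show ?thesis by (simp add: bcontfun_def)
  qed
  define S where "S v = Bcontfun (\<lambda>x. T (apply_bcontfun v) (c x))" for v :: "real \<Rightarrow>\<^sub>C 'a"
  have S: "apply_bcontfun (S v) x = T (apply_bcontfun v) (c x)" for v x
    unfolding S_def by (subst Bcontfun_inverse[OF TB]) auto
  have "\<exists>!v. S v = v"
  proof (rule banach_fix_type[where c = "1/2"])
    show "\<forall>v w. dist (S v) (S w) \<le> 1 / 2 * dist v w"
    proof (intro allI dist_bound)
      fix v w :: "real \<Rightarrow>\<^sub>C 'a" and x0 :: real
      define x where "x = c x0"
      have x: "x \<in> {0..L}" using c by (simp add: x_def)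
      have i: "G (apply_bcontfun v) integrable_on {0..x}" for v :: "real \<Rightarrow>\<^sub>C 'a"
        by (rule integrable_continuous_interval, rule continuous_on_subset[OF Gc]) (use x in auto)
      have I: "((\<lambda>s. k * dist v w * exp (2 * k * s)) has_integral
          dist v w / 2 * exp (2 * k * x) - dist v w / 2 * exp (2 * k * 0)) {0..x}"
        using x k by (intro fundamental_theorem_of_calculus)
          (auto intro!: derivative_eq_intros simp flip: has_real_derivative_iff_has_vector_derivative)
      have "norm (integral {0..x} (G v) - integral {0..x} (G w))
          = norm (integral {0..x} (\<lambda>s. G v s - G w s))"
        by (simp add: integral_diff i)
      also have "\<dots> \<le> integral {0..x} (\<lambda>s. k * dist v w * exp (2 * k * s))"
      proof (rule integral_norm_bound_integral)
        fix s assume "s \<in> {0..x}"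
        then have "norm (G v s - G w s) \<le> K * norm (exp (2 * k * s) *\<^sub>R v s - exp (2 * k * s) *\<^sub>R w s)"
          unfolding G_def using x by (intro lip) auto
        also have "\<dots> = K * (exp (2 * k * s) * dist (v s) (w s))"
          by (simp add: dist_norm flip: scaleR_diff_right)
        also have "\<dots> \<le> k * (exp (2 * k * s) * dist v w)"
          using k by (intro mult_mono dist_bounded) auto
        finally show "norm (G v s - G w s) \<le> k * dist v w * exp (2 * k * s)"
          by (simp add: mult_ac)
      qed (use i I in \<open>auto intro: integrable_diff\<close>)
      also have "\<dots> \<le> dist v w / 2 * exp (2 * k * x)"
        by (subst integral_unique[OF I]) auto
      finally have *: "norm (integral {0..x} (G v) - integral {0..x} (G w)) \<le> dist v w / 2 * exp (2 * k * x)" .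
      have "dist (S v x0) (S w x0) = exp (- 2 * k * x) * norm (integral {0..x} (G v) - integral {0..x} (G w))"
        unfolding S by (simp add: T_def x_def[symmetric] dist_norm flip: scaleR_diff_right)
      also have "\<dots> \<le> exp (- 2 * k * x) * (dist v w / 2 * exp (2 * k * x))"
        using * by (intro mult_left_mono) auto
      also have "\<dots> = 1 / 2 * dist v w"
        by (simp add: exp_minus)
      finally show "dist (S v x0) (S w x0) \<le> 1 / 2 * dist v w" .
    qed
  qed auto
  then obtain v where v: "S v = v" by blast
  define y where "y x = y0 + integral {0..x} (G v)" for x
  have yv: "exp (2 * k * x) *\<^sub>R v x = y x" if "x \<in> {0..L}" for x
  proof -
    have "v x = T v x" using S[of v x] c_id[OF that] v by simp
    then show ?thesis by (simp add: T_def y_def exp_minus)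
  qed
  have "(y has_vector_derivative F x (y x)) (at x within {0..L})" if "x \<in> {0..L}" for x
  proof -
    have "(y has_vector_derivative G v x) (at x within {0..L})"
      unfolding y_def using integral_has_vector_derivative[OF Gc[of v] that]
      by (auto intro!: derivative_eq_intros)
    then show ?thesis using yv[OF that] by (simp add: G_def)
  qed
  moreover have "y 0 = y0" by (simp add: y_def)
  ultimately show ?thesis by blast
qed

section \<open>The Pruefer angle\<close>

lemma abs_sin_diff_le: "\<bar>sin x - sin y\<bar> \<le> \<bar>x - y\<bar>" for x y :: real
proof -
  have "norm (sin x - sin y) \<le> 1 * norm (x - y)"
    by (rule field_differentiable_bound[of UNIV sin cos]) auto
  then show ?thesis by simp
qed

lemma abs_cos_diff_le: "\<bar>cos x - cos y\<bar> \<le> \<bar>x - y\<bar>" for x y :: real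
proof -
  have "norm (cos x - cos y) \<le> 1 * norm (x - y)"
    by (rule field_differentiable_bound[of UNIV cos "\<lambda>x. - sin x"])
       (auto intro!: derivative_eq_intros)
  then show ?thesis by simp
qed

lemma abs_power2_diff_le:
  fixes a b :: real
  assumes "\<bar>a\<bar> \<le> 1" "\<bar>b\<bar> \<le> 1"
  shows "\<bar>a\<^sup>2 - b\<^sup>2\<bar> \<le> 2 * \<bar>a - b\<bar>"
proof -
  have "\<bar>a\<^sup>2 - b\<^sup>2\<bar> = \<bar>a + b\<bar> * \<bar>a - b\<bar>"
    by (simp add: power2_eq_square abs_mult[symmetric] algebra_simps)
  also have "\<dots> \<le> 2 * \<bar>a - b\<bar>"
    using assms by (intro mult_right_mono) auto
  finally show ?thesis .
qed

lemma max_sin_sum: "(max 0 (sin y))\<^sup>2 + (max 0 (- sin y))\<^sup>2 = (sin y)\<^sup>2" for y :: real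
  by (auto simp: max_def)

text \<open>Squaring removes the kink of the negative part, so that Gronwall's inequality can be applied to it.\<close>

lemma DERIV_neg_part_square:
  "((\<lambda>x. (max 0 (- x))\<^sup>2) has_real_derivative - 2 * max 0 (- x)) (at x)" for x :: real
proof -
  consider "x < 0" | "x > 0" | "x = 0" by linarith
  then show ?thesis
  proof cases
    case 1
    have "((\<lambda>x. x\<^sup>2) has_real_derivative - 2 * max 0 (- x)) (at x)"
      using 1 by (auto intro!: derivative_eq_intros)
    then show ?thesis
      by (rule has_field_derivative_transform_within_open[where S = "{..<0}"]) (use 1 in auto)
  next
    case 2
    have "((\<lambda>x. 0) has_real_derivative - 2 * max 0 (- x)) (at x)"
      using 2 by (auto intro!: derivative_eq_intros)
    then show ?thesis
      by (rule has_field_derivative_transform_within_open[where S = "{0<..}"]) (use 2 in auto)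
  next
    case 3
    have "((\<lambda>h. ((max 0 (- (0 + h)))\<^sup>2 - (max 0 (- 0))\<^sup>2) / h) \<longlongrightarrow> 0) (at (0::real))"
      by (rule Lim_transform_bound[where g = "\<lambda>h. h"])
         (auto simp: max_def power2_eq_square eventually_at_filter)
    then show ?thesis using 3 by (simp add: DERIV_def)
  qed
qed

text \<open>The problem depends on two positive weights: \<open>p\<close> acts where the solution is positive and \<open>q\<close> where it is
negative. Keeping them as parameters makes the exchange \<open>u \<mapsto> -u\<close> an exchange of \<open>p\<close> and \<open>q\<close>.\<close>

locale weights =
  fixes L c C :: real and p q :: "real \<Rightarrow> real"
  assumes L_pos: "0 < L" and c_pos: "0 < c"
    and p_cont: "continuous_on {0..L} p" and q_cont: "continuous_on {0..L} q"
    and p_bounds: "\<And>x. x \<in> {0..L} \<Longrightarrow> c \<le> p x \<and> p x \<le> C"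
    and q_bounds: "\<And>x. x \<in> {0..L} \<Longrightarrow> c \<le> q x \<and> q x \<le> C"
begin

text \<open>For \<open>u = r sin y\<close> this is \<open>u (p u\<^sup>+ - q u\<^sup>-) / r\<^sup>2\<close>, and \<open>angle_field\<close> is
\<open>(u'\<^sup>2 - u u'') / r\<^sup>2\<close>, the derivative of the angle \<open>y\<close> of the point \<open>(u', u)\<close>.\<close>

definition potential :: "real \<Rightarrow> real \<Rightarrow> real" where
  "potential x y = p x * (max 0 (sin y))\<^sup>2 + q x * (max 0 (- sin y))\<^sup>2"

definition angle_field :: "real \<Rightarrow> real \<Rightarrow> real \<Rightarrow> real" where
  "angle_field lam x y = (cos y)\<^sup>2 + lam * potential x y"

definition is_angle :: "real \<Rightarrow> (real \<Rightarrow> real) \<Rightarrow> bool" where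
  "is_angle lam y \<longleftrightarrow> y 0 = 0 \<and>
     (\<forall>x\<in>{0..L}. (y has_real_derivative angle_field lam x (y x)) (at x within {0..L}))"

definition angle :: "real \<Rightarrow> real \<Rightarrow> real" where
  "angle lam = (SOME y. is_angle lam y)"

lemma C_pos: "0 < C"
  using p_bounds[of 0] L_pos c_pos by auto

lemma potential_bounds:
  assumes "x \<in> {0..L}"
  shows "c * (sin y)\<^sup>2 \<le> potential x y" "potential x y \<le> C * (sin y)\<^sup>2"
  using p_bounds[OF assms] q_bounds[OF assms] unfolding potential_def max_sin_sum[symmetric] distrib_left
  by (auto intro!: add_mono mult_right_mono)

lemma potential_lipschitz:
  assumes "x \<in> {0..L}"
  shows "\<bar>potential x y - potential x z\<bar> \<le> 4 * C * \<bar>y - z\<bar>"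
proof -
  have "\<bar>(max 0 a)\<^sup>2 - (max 0 b)\<^sup>2\<bar> \<le> 2 * \<bar>a - b\<bar>" if "\<bar>a\<bar> \<le> 1" "\<bar>b\<bar> \<le> 1" for a b :: real
    using abs_power2_diff_le[of "max 0 a" "max 0 b"] that by (auto simp: max_def split: if_splits)
  from this[of "sin y" "sin z"] this[of "- sin y" "- sin z"]
  have 1: "\<bar>(max 0 (sin y))\<^sup>2 - (max 0 (sin z))\<^sup>2\<bar> \<le> 2 * \<bar>y - z\<bar>" (is "\<bar>?A\<bar> \<le> _")
    and 2: "\<bar>(max 0 (- sin y))\<^sup>2 - (max 0 (- sin z))\<^sup>2\<bar> \<le> 2 * \<bar>y - z\<bar>" (is "\<bar>?B\<bar> \<le> _")
    using abs_sin_diff_le[of y z] abs_minus_commute[of "sin y" "sin z"] by force+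
  have "potential x y - potential x z = p x * ?A + q x * ?B"
    by (simp add: potential_def algebra_simps)
  also have "\<bar>\<dots>\<bar> \<le> \<bar>p x * ?A\<bar> + \<bar>q x * ?B\<bar>" by linarith
  also have "\<dots> \<le> C * (2 * \<bar>y - z\<bar>) + C * (2 * \<bar>y - z\<bar>)"
    unfolding abs_mult using p_bounds[OF assms] q_bounds[OF assms] c_pos
    by (intro add_mono mult_mono 1 2) linarith+
  finally show ?thesis by simp
qed

lemma angle_field_lipschitz:
  assumes "x \<in> {0..L}" "0 \<le> lam"
  shows "\<bar>angle_field lam x y - angle_field lam x z\<bar> \<le> (2 + 4 * C * lam) * \<bar>y - z\<bar>"
proof -
  have "\<bar>(cos y)\<^sup>2 - (cos z)\<^sup>2\<bar> \<le> 2 * \<bar>y - z\<bar>"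
    using abs_power2_diff_le[of "cos y" "cos z"] abs_cos_diff_le[of y z] by auto
  moreover have "\<bar>lam * (potential x y - potential x z)\<bar> \<le> lam * (4 * C * \<bar>y - z\<bar>)"
    unfolding abs_mult using potential_lipschitz[OF assms(1), of y z] assms(2)
    by (intro mult_mono) auto
  moreover have "angle_field lam x y - angle_field lam x z
      = ((cos y)\<^sup>2 - (cos z)\<^sup>2) + lam * (potential x y - potential x z)"
    by (simp add: angle_field_def algebra_simps)
  ultimately show ?thesis by (simp add: algebra_simps)
qed

lemma potential_continuous:
  "continuous_on ({0..L} \<times> UNIV) (\<lambda>z. potential (fst z) (snd z))"
proof -
  have "continuous_on ({0..L} \<times> UNIV) (\<lambda>z :: real \<times> real. p (fst z))"
    and "continuous_on ({0..L} \<times> UNIV) (\<lambda>z :: real \<times> real. q (fst z))"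
    by (rule continuous_on_compose2[OF p_cont continuous_on_fst[OF continuous_on_id]], force)
       (rule continuous_on_compose2[OF q_cont continuous_on_fst[OF continuous_on_id]], force)
  then show ?thesis unfolding potential_def by (intro continuous_intros)
qed

lemma is_angle_angle:
  assumes "0 \<le> lam"
  shows "is_angle lam (angle lam)"
proof -
  have "\<exists>y. y 0 = 0 \<and>
    (\<forall>x\<in>{0..L}. (y has_vector_derivative angle_field lam x (y x)) (at x within {0..L}))"
  proof (rule picard_lindelof)
    show "continuous_on ({0..L} \<times> UNIV) (\<lambda>z. angle_field lam (fst z) (snd z))"
      unfolding angle_field_def by (intro continuous_intros potential_continuous)
  qed (use angle_field_lipschitz assms L_pos in auto)
  then have "\<exists>y. is_angle lam y"
    by (simp add: is_angle_def has_real_derivative_iff_has_vector_derivative)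
  then show ?thesis unfolding angle_def by (rule someI_ex)
qed

lemma is_angle_continuous: "is_angle lam y \<Longrightarrow> continuous_on {0..L} y"
  unfolding is_angle_def
  by (intro DERIV_continuous_on[where D = "\<lambda>x. angle_field lam x (y x)"]) auto

lemma is_angle_DERIV:
  assumes "is_angle lam y" "x \<in> {0<..<L}"
  shows "(y has_real_derivative angle_field lam x (y x)) (at x)"
  using assms by (auto simp: is_angle_def at_within_Icc_at dest!: bspec[of _ _ x])

text \<open>Gronwall's inequality for the square of the difference. It serves twice: \<open>lam' = lam\<close> gives uniqueness, and the
factor \<open>\<bar>lam - lam'\<bar>\<close> gives continuity in the parameter. The exponent does not involve \<open>lam'\<close>, which may therefore
vary in the limit.\<close>

lemma is_angle_dependence:
  assumes y: "is_angle lam y" and z: "is_angle lam' z" and "0 \<le> lam" and x: "x \<in> {0..L}"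
  shows "(y x - z x)\<^sup>2 \<le> (C * \<bar>lam - lam'\<bar>)\<^sup>2 * x * exp ((2 * (2 + 4 * C * lam) + 1) * x)"
proof -
  let ?K = "2 + 4 * C * lam" and ?e = "C * \<bar>lam - lam'\<bar>"
  let ?d = "\<lambda>x. angle_field lam x (y x) - angle_field lam' x (z x)"
  show ?thesis
  proof (rule gronwall_inequality[where L = L and f' = "\<lambda>x. 2 * (y x - z x) * ?d x"])
    show "continuous_on {0..L} (\<lambda>x. (y x - z x)\<^sup>2)"
      by (intro continuous_intros is_angle_continuous[OF y] is_angle_continuous[OF z])
    show "((\<lambda>x. (y x - z x)\<^sup>2) has_real_derivative 2 * (y x - z x) * ?d x) (at x)"
      if "x \<in> {0<..<L}" for x
      using is_angle_DERIV[OF y that] is_angle_DERIV[OF z that]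
      by (auto intro!: derivative_eq_intros)
    show "2 * (y x - z x) * ?d x \<le> (2 * ?K + 1) * (y x - z x)\<^sup>2 + ?e\<^sup>2"
      if x: "x \<in> {0<..<L}" for x
    proof -
      let ?u = "\<bar>y x - z x\<bar>"
      have xL: "x \<in> {0..L}" using x by auto
      have "potential x (z x) \<le> C * 1"
        by (rule order_trans[OF potential_bounds(2)[OF xL]])
           (use C_pos in \<open>intro mult_left_mono; simp add: abs_square_le_1\<close>)
      moreover have "0 \<le> potential x (z x)"
        by (rule order_trans[OF _ potential_bounds(1)[OF xL]]) (use c_pos in simp)
      ultimately have P: "\<bar>(lam - lam') * potential x (z x)\<bar> \<le> ?e"
        unfolding abs_mult by (subst mult.commute) (intro mult_right_mono, auto)
      have "?d x = (angle_field lam x (y x) - angle_field lam x (z x)) + (lam - lam') * potential x (z x)"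
        by (simp add: angle_field_def algebra_simps)
      then have "\<bar>?d x\<bar> \<le> ?K * ?u + ?e"
        using angle_field_lipschitz[OF xL \<open>0 \<le> lam\<close>, of "y x" "z x"] P by linarith
      then have "\<bar>2 * (y x - z x) * ?d x\<bar> \<le> 2 * ?u * (?K * ?u + ?e)"
        unfolding abs_mult by (intro mult_mono) auto
      also have "\<dots> = 2 * ?K * ?u\<^sup>2 + 2 * ?u * ?e"
        by (simp add: power2_eq_square algebra_simps)
      also have "2 * ?u * ?e \<le> ?u\<^sup>2 + ?e\<^sup>2"
        by (rule sum_squares_bound)
      finally show ?thesis by (simp add: algebra_simps)
    qed
  qed (use y z x C_pos \<open>0 \<le> lam\<close> in \<open>auto simp: is_angle_def\<close>)
qed

lemma is_angle_unique:
  assumes "is_angle lam y" "0 \<le> lam" "x \<in> {0..L}"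
  shows "y x = angle lam x"
  using is_angle_dependence[OF assms(1) is_angle_angle[OF assms(2)] assms(2,3)] by simp

lemma angle_continuous_in_eigenvalue: "continuous_on {0..} (\<lambda>lam. angle lam L)"
  unfolding continuous_on_def
proof
  fix lam :: real assume "lam \<in> {0..}"
  then have lam: "0 \<le> lam" by simp
  define D where "D = L * exp ((2 * (2 + 4 * C * lam) + 1) * L)"
  have D: "0 \<le> D" using L_pos by (simp add: D_def)
  have bound: "norm (angle mu L - angle lam L) \<le> norm (C * \<bar>lam - mu\<bar> * sqrt D)" if "0 \<le> mu" for mu
  proof -
    have "(angle mu L - angle lam L)\<^sup>2 \<le> (C * \<bar>lam - mu\<bar>)\<^sup>2 * L * exp ((2 * (2 + 4 * C * lam) + 1) * L)"
      using is_angle_dependence[OF is_angle_angle[OF lam] is_angle_angle[OF that] lam, of L] L_pos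
      by (simp add: power2_commute)
    also have "\<dots> = (C * \<bar>lam - mu\<bar> * sqrt D)\<^sup>2"
      using D by (simp add: power_mult_distrib D_def mult_ac)
    finally show ?thesis by (simp only: abs_le_square_iff real_norm_def)
  qed
  have "((\<lambda>mu. C * \<bar>lam - mu\<bar> * sqrt D) \<longlongrightarrow> 0) (at lam within {0..})"
    by (auto intro!: tendsto_eq_intros)
  then have "((\<lambda>mu. angle mu L - angle lam L) \<longlongrightarrow> 0) (at lam within {0..})"
    by (rule Lim_transform_bound[rotated]) (auto simp: eventually_at_filter intro!: always_eventually bound[simplified])
  then show "((\<lambda>mu. angle mu L) \<longlongrightarrow> angle lam L) (at lam within {0..})"
    by (rule Lim_null[THEN iffD2])
qed

text \<open>For \<open>lam = 0\<close> the equation is \<open>y' = (cos y)\<^sup>2\<close>, solved by the arctangent.\<close>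

lemma angle_zero: "angle 0 L < pi"
proof -
  have "is_angle 0 arctan"
    by (auto simp: is_angle_def angle_field_def cos_arctan power_divide
        intro!: derivative_eq_intros simp: field_simps)
  then have "angle 0 L = arctan L"
    using is_angle_unique[of 0 arctan L] L_pos by simp
  then show ?thesis using arctan_ubound[of L] pi_gt_zero by linarith
qed

text \<open>Let \<open>d\<close> be the difference of the two angles. By the Lipschitz bound, \<open>d'\<close> is at least
\<open>(lam' - lam) potential - K \<bar>d\<bar>\<close>. Gronwall's inequality for the square of the negative part of \<open>d\<close> gives
\<open>d \<ge> 0\<close>, after which \<open>exp (K x) d x\<close> is increasing. If \<open>d L\<close> were zero, it would be constant, hence the
potential would vanish along the angle; the sine of the angle would be identically zero, which is impossible since
the angle moves with speed \<open>1\<close> at the zeros of the sine.\<close>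

lemma angle_strict_mono:
  assumes "0 \<le> lam" "lam < lam'"
  shows "angle lam L < angle lam' L"
proof -
  have y: "is_angle lam (angle lam)" and z: "is_angle lam' (angle lam')"
    using assms by (auto intro: is_angle_angle)
  let ?y = "angle lam" and ?z = "angle lam'"
  define K where "K = 2 + 4 * C * lam'"
  have K: "0 \<le> K" using C_pos assms by (simp add: K_def)
  define d where "d x = ?z x - ?y x" for x
  define d' where "d' x = angle_field lam' x (?z x) - angle_field lam x (?y x)" for x
  have dc: "continuous_on {0..L} d"
    unfolding d_def by (intro continuous_intros is_angle_continuous[OF y] is_angle_continuous[OF z])
  have dd: "(d has_real_derivative d' x) (at x)" if "x \<in> {0<..<L}" for x
    unfolding d_def[abs_def] d'_def using is_angle_DERIV[OF y that] is_angle_DERIV[OF z that]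
    by (auto intro!: derivative_eq_intros)
  have d0: "d 0 = 0" using y z by (simp add: d_def is_angle_def)
  have d'_ge: "(lam' - lam) * potential x (?y x) - K * \<bar>d x\<bar> \<le> d' x" if "x \<in> {0..L}" for x
  proof -
    have "d' x = (angle_field lam' x (?z x) - angle_field lam' x (?y x)) + (lam' - lam) * potential x (?y x)"
      by (simp add: d'_def angle_field_def algebra_simps)
    moreover have "\<bar>angle_field lam' x (?z x) - angle_field lam' x (?y x)\<bar> \<le> K * \<bar>d x\<bar>"
      unfolding K_def d_def using assms by (intro angle_field_lipschitz[OF that]) auto
    ultimately show ?thesis by linarith
  qed
  have pot: "0 \<le> potential x y" if "x \<in> {0..L}" for x y
    by (rule order_trans[OF _ potential_bounds(1)[OF that]]) (use c_pos in simp)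
  have d_nonneg: "0 \<le> d x" if x: "x \<in> {0..L}" for x
  proof -
    have "(max 0 (- d x))\<^sup>2 \<le> 0 * x * exp ((2 * K) * x)"
    proof (rule gronwall_inequality[where L = L and f' = "\<lambda>x. - 2 * max 0 (- d x) * d' x"])
      show "continuous_on {0..L} (\<lambda>x. (max 0 (- d x))\<^sup>2)"
        by (intro continuous_intros dc)
      show "((\<lambda>x. (max 0 (- d x))\<^sup>2) has_real_derivative - 2 * max 0 (- d x) * d' x) (at x)"
        if "x \<in> {0<..<L}" for x
        using DERIV_chain2[OF DERIV_neg_part_square dd[OF that]] by simp
      show "- 2 * max 0 (- d x) * d' x \<le> 2 * K * (max 0 (- d x))\<^sup>2 + 0" if x: "x \<in> {0<..<L}" for x
      proof (cases "d x < 0")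
        case True
        have "0 \<le> (lam' - lam) * potential x (?y x)"
          using assms pot[of x] x by (intro mult_nonneg_nonneg) auto
        then have "K * d x \<le> d' x" using d'_ge[of x] x True by auto
        then have "(- 2 * d x) * (K * d x) \<le> (- 2 * d x) * d' x"
          by (rule mult_left_mono) (use True in auto)
        then show ?thesis using True by (simp add: power2_eq_square algebra_simps)
      qed auto
    qed (use d0 K x in auto)
    then show ?thesis by (simp add: max_def split: if_splits)
  qed
  have e_deriv: "((\<lambda>x. exp (K * x) * d x) has_real_derivative exp (K * x) * (K * d x + d' x)) (at x)"
    if "x \<in> {0<..<L}" for x
    using dd[OF that] by (auto intro!: derivative_eq_intros simp: algebra_simps)
  have e_ge: "(lam' - lam) * potential x (?y x) \<le> K * d x + d' x" if "x \<in> {0<..<L}" for x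
    using d'_ge[of x] d_nonneg[of x] that by auto
  have e_mono: "exp (K * a) * d a \<le> exp (K * b) * d b" if "0 \<le> a" "a \<le> b" "b \<le> L" for a b
  proof (rule DERIV_nonneg_imp_increasing_open[where f = "\<lambda>x. exp (K * x) * d x"])
    show "continuous_on {a..b} (\<lambda>x. exp (K * x) * d x)"
      using that by (intro continuous_intros continuous_on_subset[OF dc]) auto
    fix x assume "a < x" "x < b"
    then have x: "x \<in> {0<..<L}" using that by auto
    have "0 \<le> (lam' - lam) * potential x (?y x)"
      using assms pot[of x] x by (intro mult_nonneg_nonneg) auto
    then have "0 \<le> exp (K * x) * (K * d x + d' x)"
      using e_ge[OF x] by (intro mult_nonneg_nonneg) auto
    then show "\<exists>y. ((\<lambda>x. exp (K * x) * d x) has_real_derivative y) (at x) \<and> 0 \<le> y"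
      using e_deriv[OF x] by blast
  qed (use that in auto)
  have "d L \<noteq> 0"
  proof
    assume dL: "d L = 0"
    have dz: "d x = 0" if "x \<in> {0..L}" for x
      using e_mono[of x L] d_nonneg[OF that] that dL
      by (auto simp: mult_le_0_iff)
    have sz: "sin (?y x) = 0" if x: "x \<in> {0<..<L}" for x
    proof -
      have "((\<lambda>x. 0) has_real_derivative d' x) (at x)"
        by (rule has_field_derivative_transform_within_open[OF dd[OF x], where S = "{0<..<L}"])
           (use x dz in auto)
      then have "d' x = 0" by (metis DERIV_const DERIV_unique)
      then have "(lam' - lam) * potential x (?y x) \<le> 0"
        using e_ge[OF x] dz[of x] x by simp
      then have "potential x (?y x) \<le> 0" using assms by (simp add: mult_le_0_iff)
      then have "c * (sin (?y x))\<^sup>2 \<le> 0" using potential_bounds(1)[of x "?y x"] x by auto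
      then show ?thesis using c_pos by (simp add: mult_le_0_iff)
    qed
    have x: "L / 2 \<in> {0<..<L}" using L_pos by auto
    have "((\<lambda>x. sin (?y x)) has_real_derivative cos (?y (L/2)) * angle_field lam (L/2) (?y (L/2))) (at (L/2))"
      using is_angle_DERIV[OF y x] by (auto intro!: derivative_eq_intros)
    then have "((\<lambda>x. 0) has_real_derivative cos (?y (L/2)) * angle_field lam (L/2) (?y (L/2))) (at (L/2))"
      by (rule has_field_derivative_transform_within_open[where S = "{0<..<L}"]) (use x sz in auto)
    then have "cos (?y (L/2)) * angle_field lam (L/2) (?y (L/2)) = 0"
      by (metis DERIV_const DERIV_unique)
    moreover have c: "(cos (?y (L/2)))\<^sup>2 = 1" using sz[OF x] by (simp add: cos_squared_eq)
    ultimately have "angle_field lam (L/2) (?y (L/2)) = 0" by auto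
    then show False using c pot[of "L/2" "?y (L/2)"] x assms by (simp add: angle_field_def add_nonneg_eq_0_iff)
  qed
  then show ?thesis using d_nonneg[of L] L_pos by (simp add: d_def)
qed

end

section \<open>The angle grows without bound in the parameter\<close>

text \<open>The continuous branch of \<open>arctan (a tan y)\<close> that fixes the multiples of \<open>\<pi>/2\<close>. The formula for the tangent of a
difference gives the distance to \<open>y\<close> as an arctangent without singularities, which makes the function smooth on the
whole line and within \<open>\<pi>/2\<close> of the identity.\<close>

definition elliptic_phase :: "real \<Rightarrow> real \<Rightarrow> real" where
  "elliptic_phase a y = y + arctan ((a - 1) * sin y * cos y / ((cos y)\<^sup>2 + a * (sin y)\<^sup>2))"

lemma elliptic_form_pos:
  fixes a y :: real
  assumes "0 < a"
  shows "0 < (cos y)\<^sup>2 + a * (sin y)\<^sup>2"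
proof (cases "sin y = 0")
  case True
  then show ?thesis using sin_cos_squared_add[of y] by simp
next
  case False
  then show ?thesis using assms by (intro add_nonneg_pos) auto
qed

lemma elliptic_phase_deriv:
  assumes "0 < a"
  shows "(elliptic_phase a has_real_derivative a / ((cos y)\<^sup>2 + a\<^sup>2 * (sin y)\<^sup>2)) (at y)"
proof -
  define s c where "s = sin y" and "c = cos y"
  have sc: "s\<^sup>2 = 1 - c\<^sup>2" by (simp add: s_def c_def sin_squared_eq)
  define D where "D = c\<^sup>2 + a * s\<^sup>2"
  define E where "E = c\<^sup>2 + a\<^sup>2 * s\<^sup>2"
  have D: "0 < D" unfolding D_def s_def c_def by (rule elliptic_form_pos[OF assms])
  have E: "0 < E" unfolding E_def s_def c_def using assms by (intro elliptic_form_pos) simp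
  define N where "N = (a - 1) * (c\<^sup>2 - s\<^sup>2) * D - (a - 1) * s * c * (2 * (a - 1) * s * c)"
  define w where "w = (a - 1) * s * c / D"
  have w: "1 + w\<^sup>2 = E / D\<^sup>2"
  proof -
    have "D\<^sup>2 + ((a - 1) * s * c)\<^sup>2 = (c\<^sup>2 + s\<^sup>2) * E"
      unfolding D_def E_def by (simp add: power2_eq_square algebra_simps)
    then have "D\<^sup>2 + ((a - 1) * s * c)\<^sup>2 = E" using sc by simp
    then show ?thesis using D by (simp add: w_def power_divide field_simps)
  qed
  have N: "N = a - E"
  proof -
    have "N = (a - 1) * (c\<^sup>2 + s\<^sup>2) * (c\<^sup>2 - a * s\<^sup>2)"
      unfolding N_def D_def by (simp add: power2_eq_square algebra_simps)
    also have "\<dots> = (a - 1) * (c\<^sup>2 - a * s\<^sup>2)" using sc by simp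
    also have "\<dots> = a * (c\<^sup>2 + s\<^sup>2) - E"
      unfolding E_def by (simp add: power2_eq_square algebra_simps)
    finally show ?thesis using sc by simp
  qed
  have "((\<lambda>y. (cos y)\<^sup>2 + a * (sin y)\<^sup>2) has_real_derivative 2 * (a - 1) * s * c) (at y)"
    unfolding s_def c_def by (auto intro!: derivative_eq_intros simp: algebra_simps)
  moreover have "((\<lambda>y. (a - 1) * sin y * cos y) has_real_derivative (a - 1) * (c\<^sup>2 - s\<^sup>2)) (at y)"
    unfolding s_def c_def by (auto intro!: derivative_eq_intros simp: algebra_simps power2_eq_square)
  ultimately have "((\<lambda>y. (a - 1) * sin y * cos y / ((cos y)\<^sup>2 + a * (sin y)\<^sup>2)) has_real_derivative N / D\<^sup>2) (at y)"
    using D unfolding N_def s_def c_def D_def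
    by (intro DERIV_cong[OF DERIV_divide]) (auto simp: power2_eq_square)
  then have "((\<lambda>y. arctan ((a - 1) * sin y * cos y / ((cos y)\<^sup>2 + a * (sin y)\<^sup>2)))
      has_real_derivative inverse (1 + w\<^sup>2) * (N / D\<^sup>2)) (at y)"
    unfolding w_def s_def c_def D_def by (rule DERIV_chain2[OF DERIV_arctan])
  moreover have "inverse (1 + w\<^sup>2) * (N / D\<^sup>2) = N / E"
    unfolding w using D E by (simp add: field_simps)
  ultimately have "(elliptic_phase a has_real_derivative 1 + N / E) (at y)"
    unfolding elliptic_phase_def[abs_def] by (intro DERIV_add DERIV_ident) simp
  moreover have "1 + N / E = a / E" unfolding N using E by (simp add: field_simps)
  ultimately show ?thesis by (simp add: E_def s_def c_def)
qed

lemma elliptic_phase_near: "\<bar>elliptic_phase a y - y\<bar> < pi / 2"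
  unfolding elliptic_phase_def
  using arctan_bounded[of "(a - 1) * sin y * cos y / ((cos y)\<^sup>2 + a * (sin y)\<^sup>2)"] by linarith

lemma elliptic_phase_of_nat_pi [simp]:
  "elliptic_phase a 0 = 0" "elliptic_phase a pi = pi" "elliptic_phase a (2 * pi) = 2 * pi"
  by (simp_all add: elliptic_phase_def)

context weights
begin

lemma angle_field_ge:
  assumes "x \<in> {0..L}" "0 \<le> lam"
  shows "(cos y)\<^sup>2 + lam * c * (sin y)\<^sup>2 \<le> angle_field lam x y"
  using potential_bounds(1)[OF assms(1), of y] assms(2)
  by (auto simp: angle_field_def mult.assoc intro!: mult_left_mono)

lemma angle_strictly_increasing:
  assumes "0 < lam" "0 \<le> a" "a < b" "b \<le> L"
  shows "angle lam a < angle lam b"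
proof (rule DERIV_pos_imp_increasing_open[OF \<open>a < b\<close>])
  have y: "is_angle lam (angle lam)" using assms by (intro is_angle_angle) auto
  show "continuous_on {a..b} (angle lam)"
    by (rule continuous_on_subset[OF is_angle_continuous[OF y]]) (use assms in auto)
  fix x assume "a < x" "x < b"
  then have x: "x \<in> {0<..<L}" using assms by auto
  have "0 < angle_field lam x (angle lam x)"
    using angle_field_ge[of x lam "angle lam x"] elliptic_form_pos[of "lam * c" "angle lam x"] x c_pos assms
    by (auto intro: less_le_trans)
  then show "\<exists>y. (angle lam has_real_derivative y) (at x) \<and> 0 < y"
    using is_angle_DERIV[OF y x] by blast
qed

lemma angle_0: "0 \<le> lam \<Longrightarrow> angle lam 0 = 0"
  using is_angle_angle by (auto simp: is_angle_def)

text \<open>Applying the phase with \<open>a\<^sup>2 = lam c\<close> to the angle compares the equation with the one for the constant weight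
\<open>c\<close>: the phase of the angle has derivative at least \<open>a\<close>.\<close>

lemma angle_ge:
  assumes "0 < lam"
  shows "sqrt (lam * c) * L - pi / 2 \<le> angle lam L"
proof -
  define a where "a = sqrt (lam * c)"
  have a: "0 < a" "a\<^sup>2 = lam * c" using assms c_pos by (auto simp: a_def)
  have y: "is_angle lam (angle lam)" using assms by (intro is_angle_angle) auto
  let ?g = "\<lambda>x. elliptic_phase a (angle lam x) - a * x"
  have "?g 0 \<le> ?g L"
  proof (rule DERIV_nonneg_imp_increasing_open[where f = ?g])
    have "continuous_on UNIV (elliptic_phase a)"
      using DERIV_isCont[OF elliptic_phase_deriv[OF a(1)]] by (simp add: continuous_at_imp_continuous_on)
    then have "continuous_on {0..L} (\<lambda>x. elliptic_phase a (angle lam x))"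
      by (rule continuous_on_compose2[OF _ is_angle_continuous[OF y]]) simp
    then show "continuous_on {0..L} ?g"
      by (intro continuous_intros)
    fix x assume "0 < x" "x < L"
    then have x: "x \<in> {0<..<L}" by auto
    let ?y = "angle lam x"
    let ?E = "(cos ?y)\<^sup>2 + a\<^sup>2 * (sin ?y)\<^sup>2"
    have E: "0 < ?E" using a(1) by (intro elliptic_form_pos) simp
    have "?E \<le> angle_field lam x ?y"
      using angle_field_ge[of x lam ?y] x assms a by simp
    then have "a * ?E \<le> a * angle_field lam x ?y" using a by (intro mult_left_mono) auto
    then have "0 \<le> a / ?E * angle_field lam x ?y - a" using E by (simp add: field_simps)
    moreover have "(?g has_real_derivative a / ?E * angle_field lam x ?y - a) (at x)"
      using DERIV_chain2[OF elliptic_phase_deriv[OF a(1)] is_angle_DERIV[OF y x]]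
      by (auto intro!: derivative_eq_intros)
    ultimately show "\<exists>y. (?g has_real_derivative y) (at x) \<and> 0 \<le> y" by blast
  qed (use L_pos in auto)
  then have "a * L \<le> elliptic_phase a (angle lam L)"
    using angle_0[of lam] assms by simp
  then show ?thesis using elliptic_phase_near[of a "angle lam L"] unfolding a_def by linarith
qed

text \<open>The intermediate value theorem between \<open>0\<close> and a parameter \<open>mu\<close> that is so large that the lower bound of
\<open>angle_ge\<close> is \<open>k \<pi>\<close>.\<close>

lemma angle_attains:
  assumes "1 \<le> k"
  shows "\<exists>!lam. 0 < lam \<and> angle lam L = real k * pi"
proof (rule ex_ex1I)
  define mu where "mu = ((real k * pi + pi / 2) / L)\<^sup>2 / c"
  have mu: "0 \<le> mu" using c_pos by (simp add: mu_def)
  have "0 < real k * pi + pi / 2" using pi_gt_zero by (simp add: add_nonneg_pos)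
  then have "0 < mu" using c_pos L_pos by (simp add: mu_def)
  have "sqrt (mu * c) * L = real k * pi + pi / 2"
    using c_pos L_pos pi_gt_zero by (simp add: mu_def real_sqrt_divide)
  then have "real k * pi \<le> angle mu L" using angle_ge[OF \<open>0 < mu\<close>] by simp
  moreover have lt: "angle 0 L < real k * pi"
    using angle_zero assms pi_gt_zero by (smt (verit) mult_le_cancel_right1 of_nat_1 of_nat_le_iff)
  ultimately obtain lam where "0 \<le> lam" "angle lam L = real k * pi"
    using IVT'[of "\<lambda>lam. angle lam L" 0 "real k * pi" mu] mu
      continuous_on_subset[OF angle_continuous_in_eigenvalue, of "{0..mu}"] by auto
  moreover have "lam \<noteq> 0" using calculation lt by auto
  ultimately show "\<exists>lam. 0 < lam \<and> angle lam L = real k * pi" by (metis less_eq_real_def)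
next
  fix a b :: real assume "0 < a \<and> angle a L = real k * pi" "0 < b \<and> angle b L = real k * pi"
  then show "a = b"
    using angle_strict_mono[of a b] angle_strict_mono[of b a] by (cases a b rule: linorder_cases) auto
qed

section \<open>Eigenfunctions and nodal domains\<close>

text \<open>The eigenvalue problem without the condition at \<open>L\<close>, to which uniqueness for given \<open>u' 0\<close> applies.\<close>

definition solves_ivp :: "real \<Rightarrow> (real \<Rightarrow> real) \<Rightarrow> (real \<Rightarrow> real) \<Rightarrow> bool" where
  "solves_ivp lam u u' \<longleftrightarrow>
     (\<forall>x\<in>{0..L}. (u has_real_derivative u' x) (at x within {0..L})) \<and>
     continuous_on {0..L} u' \<and>
     (\<forall>x\<in>{0<..<L}. (u' has_real_derivative
        - (lam * (p x * pos_part u x - q x * neg_part u x))) (at x)) \<and>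
     u 0 = 0"

lemma solves_problem_iff_ivp: "solves_problem p q 1 L lam u u' \<longleftrightarrow> solves_ivp lam u u' \<and> u L = 0"
  by (auto simp: solves_problem_def solves_ivp_def)

text \<open>The energy \<open>(u - v)\<^sup>2 + (u' - v')\<^sup>2\<close> satisfies a linear differential inequality, since the positive and
negative parts are Lipschitz functions.\<close>

lemma solves_ivp_unique:
  assumes u: "solves_ivp lam u u'" and v: "solves_ivp lam v v'" and "u' 0 = v' 0" "0 \<le> lam"
    and x: "x \<in> {0..L}"
  shows "u x = v x"
proof -
  define N where "N w x = p x * pos_part w x - q x * neg_part w x" for w x
  define E where "E x = (u x - v x)\<^sup>2 + (u' x - v' x)\<^sup>2" for x
  define E' where "E' x = 2 * (u x - v x) * (u' x - v' x) - 2 * lam * (u' x - v' x) * (N u x - N v x)" for x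
  have "E x \<le> 0 * x * exp ((1 + 2 * lam * C) * x)"
  proof (rule gronwall_inequality[where L = L and f = E and f' = E'])
    have "continuous_on {0..L} u" "continuous_on {0..L} v"
      by (rule DERIV_continuous_on[where D = u'], use u in \<open>simp add: solves_ivp_def\<close>)
         (rule DERIV_continuous_on[where D = v'], use v in \<open>simp add: solves_ivp_def\<close>)
    moreover have "continuous_on {0..L} u'" "continuous_on {0..L} v'"
      using u v unfolding solves_ivp_def by blast+
    ultimately show "continuous_on {0..L} E" unfolding E_def by (intro continuous_intros)
    fix x assume x: "x \<in> {0<..<L}"
    have "x \<in> {0..L}" "at x within {0..L} = at x" using x at_within_Icc_at[of 0 x L] by auto
    then have "(u has_real_derivative u' x) (at x)" "(v has_real_derivative v' x) (at x)"
      using u v unfolding solves_ivp_def by metis+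
    moreover have "(u' has_real_derivative - (lam * N u x)) (at x)" "(v' has_real_derivative - (lam * N v x)) (at x)"
      using u v x unfolding solves_ivp_def N_def by auto
    ultimately show "(E has_real_derivative E' x) (at x)"
      unfolding E_def E'_def by (auto intro!: derivative_eq_intros simp: algebra_simps)
    let ?a = "\<bar>u x - v x\<bar>" and ?b = "\<bar>u' x - v' x\<bar>"
    have pq: "0 \<le> p x" "p x \<le> C" "0 \<le> q x" "q x \<le> C"
      using p_bounds[of x] q_bounds[of x] x c_pos by auto
    have "N u x - N v x = p x * (pos_part u x - pos_part v x) + q x * (neg_part v x - neg_part u x)"
      by (simp add: N_def algebra_simps)
    also have "\<bar>\<dots>\<bar> \<le> p x * \<bar>pos_part u x - pos_part v x\<bar> + q x * \<bar>neg_part v x - neg_part u x\<bar>"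
      using abs_triangle_ineq[of "p x * (pos_part u x - pos_part v x)" "q x * (neg_part v x - neg_part u x)"] pq
      by (simp add: abs_mult)
    also have "\<dots> \<le> C * ?a + C * ?a"
      using pq by (intro add_mono mult_mono) (auto simp: pos_part_def neg_part_def)
    finally have N: "\<bar>N u x - N v x\<bar> \<le> 2 * C * ?a" by simp
    have ab: "2 * ?a * ?b \<le> E x" using sum_squares_bound[of ?a ?b] by (simp add: E_def)
    have "\<bar>2 * lam * (u' x - v' x) * (N u x - N v x)\<bar> \<le> 2 * lam * ?b * (2 * C * ?a)"
      unfolding abs_mult using N \<open>0 \<le> lam\<close> by (intro mult_mono) auto
    also have "\<dots> = 2 * lam * C * (2 * ?a * ?b)" by simp
    also have "\<dots> \<le> 2 * lam * C * E x"
      using ab \<open>0 \<le> lam\<close> C_pos by (intro mult_left_mono) auto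
    finally have "\<bar>2 * lam * (u' x - v' x) * (N u x - N v x)\<bar> \<le> 2 * lam * C * E x" .
    moreover have "\<bar>2 * (u x - v x) * (u' x - v' x)\<bar> \<le> E x"
      unfolding abs_mult using ab by simp
    ultimately show "E' x \<le> (1 + 2 * lam * C) * E x + 0"
      unfolding E'_def by (simp add: algebra_simps)
  qed (use u v assms C_pos in \<open>auto simp: E_def solves_ivp_def\<close>)
  then have "E x \<le> 0" by simp
  moreover have "(u x - v x)\<^sup>2 \<le> E x" by (simp add: E_def)
  ultimately have "(u x - v x)\<^sup>2 \<le> 0" by linarith
  then show ?thesis by simp
qed

lemma solves_ivp_scale:
  assumes "solves_ivp lam u u'" "0 < a"
  shows "solves_ivp lam (\<lambda>x. a * u x) (\<lambda>x. a * u' x)"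
proof -
  have "pos_part (\<lambda>x. a * u x) x = a * pos_part u x" "neg_part (\<lambda>x. a * u x) x = a * neg_part u x" for x
    using assms(2) by (auto simp: pos_part_def neg_part_def max_def mult_le_0_iff zero_le_mult_iff)
  then have f: "- (lam * (p x * pos_part (\<lambda>x. a * u x) x - q x * neg_part (\<lambda>x. a * u x) x))
      = a * - (lam * (p x * pos_part u x - q x * neg_part u x))" for x
    by (simp add: algebra_simps)
  show ?thesis
    unfolding solves_ivp_def f
  proof (intro conjI ballI)
    fix x assume "x \<in> {0<..<L}"
    then show "((\<lambda>x. a * u' x) has_real_derivative a * - (lam * (p x * pos_part u x - q x * neg_part u x))) (at x)"
      using assms(1) unfolding solves_ivp_def by (intro DERIV_cmult) blast
  qed (use assms(1) in \<open>auto simp: solves_ivp_def intro!: DERIV_cmult continuous_on_mult_left\<close>)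
qed

text \<open>The amplitude \<open>r\<close> belonging to the angle solves a linear equation and is therefore an exponential, in particular
positive.\<close>

lemma solves_ivp_from_angle:
  assumes "0 \<le> lam"
  shows "\<exists>r. (\<forall>x. 0 < r x) \<and> r 0 = 1 \<and>
    solves_ivp lam (\<lambda>x. r x * sin (angle lam x)) (\<lambda>x. r x * cos (angle lam x))"
proof -
  have y: "is_angle lam (angle lam)" using assms by (rule is_angle_angle)
  define V where "V x = p x * max 0 (sin (angle lam x)) - q x * max 0 (- sin (angle lam x))" for x
  define g where "g x = cos (angle lam x) * (sin (angle lam x) - lam * V x)" for x
  define r where "r x = exp (integral {0..x} g)" for x
  have "continuous_on {0..L} g"
    unfolding g_def V_def by (intro continuous_intros is_angle_continuous[OF y] p_cont q_cont)
  then have r: "(r has_real_derivative r x * g x) (at x within {0..L})" if "x \<in> {0..L}" for x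
    unfolding r_def using integral_has_real_derivative[of 0 L g x] that
    by (auto intro!: derivative_eq_intros)
  have yd: "(angle lam has_real_derivative (cos (angle lam x))\<^sup>2 + lam * (V x * sin (angle lam x))) (at x within {0..L})"
    if "x \<in> {0..L}" for x
  proof -
    have "potential x (angle lam x) = V x * sin (angle lam x)"
      by (simp add: potential_def V_def max_def power2_eq_square)
    moreover have "(angle lam has_real_derivative angle_field lam x (angle lam x)) (at x within {0..L})"
      using y that unfolding is_angle_def by blast
    ultimately show ?thesis by (simp add: angle_field_def)
  qed
  \<comment> \<open>The identities below are those for \<open>(r sin y)'\<close> and \<open>(r cos y)'\<close>,
    with \<open>s = sin y\<close>, \<open>k = cos y\<close> and \<open>v\<close> the value of \<open>V\<close>.\<close>
  have id: "s\<^sup>2 = 1 - k\<^sup>2 \<Longrightarrow> k * (s - lam * v) * s + (k * (k\<^sup>2 + lam * (v * s))) = k"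
           "s\<^sup>2 = 1 - k\<^sup>2 \<Longrightarrow> k * (s - lam * v) * k - s * (k\<^sup>2 + lam * (v * s)) = - lam * v" for s k v :: real
  proof -
    assume "s\<^sup>2 = 1 - k\<^sup>2"
    have "k * (s - lam * v) * s + (k * (k\<^sup>2 + lam * (v * s))) = k * (s\<^sup>2 + k\<^sup>2)"
      by (simp add: power2_eq_square algebra_simps)
    then show "k * (s - lam * v) * s + (k * (k\<^sup>2 + lam * (v * s))) = k"
      using \<open>s\<^sup>2 = 1 - k\<^sup>2\<close> by simp
    have "k * (s - lam * v) * k - s * (k\<^sup>2 + lam * (v * s)) = - lam * v * (s\<^sup>2 + k\<^sup>2)"
      by (simp add: power2_eq_square algebra_simps)
    then show "k * (s - lam * v) * k - s * (k\<^sup>2 + lam * (v * s)) = - lam * v"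
      using \<open>s\<^sup>2 = 1 - k\<^sup>2\<close> by simp
  qed
  have u: "((\<lambda>x. r x * sin (angle lam x)) has_real_derivative r x * cos (angle lam x)) (at x within {0..L})"
    if "x \<in> {0..L}" for x
  proof -
    have "((\<lambda>x. r x * sin (angle lam x)) has_real_derivative
        r x * (g x * sin (angle lam x) + cos (angle lam x) * ((cos (angle lam x))\<^sup>2 + lam * (V x * sin (angle lam x)))))
        (at x within {0..L})"
      using r[OF that] yd[OF that] by (auto intro!: derivative_eq_intros simp: algebra_simps)
    then show ?thesis unfolding g_def by (subst (asm) id(1)) (simp_all add: sin_squared_eq)
  qed
  have u': "((\<lambda>x. r x * cos (angle lam x)) has_real_derivative - (lam * (r x * V x))) (at x within {0..L})"
    if "x \<in> {0..L}" for x
  proof -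
    have "((\<lambda>x. r x * cos (angle lam x)) has_real_derivative
        r x * (g x * cos (angle lam x) - sin (angle lam x) * ((cos (angle lam x))\<^sup>2 + lam * (V x * sin (angle lam x)))))
        (at x within {0..L})"
      using r[OF that] yd[OF that] by (auto intro!: derivative_eq_intros simp: algebra_simps)
    then show ?thesis unfolding g_def by (subst (asm) id(2)) (simp_all add: sin_squared_eq mult_ac)
  qed
  have r_pos: "0 < r x" for x by (simp add: r_def)
  have V: "p x * pos_part (\<lambda>x. r x * sin (angle lam x)) x - q x * neg_part (\<lambda>x. r x * sin (angle lam x)) x
      = r x * V x" for x
    using r_pos[of x]
    by (auto simp: V_def pos_part_def neg_part_def max_def mult_le_0_iff zero_le_mult_iff algebra_simps)
  have "solves_ivp lam (\<lambda>x. r x * sin (angle lam x)) (\<lambda>x. r x * cos (angle lam x))"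
    unfolding solves_ivp_def V
  proof (intro conjI ballI)
    show "continuous_on {0..L} (\<lambda>x. r x * cos (angle lam x))"
      by (rule DERIV_continuous_on[OF u'])
    show "((\<lambda>x. r x * cos (angle lam x)) has_real_derivative - (lam * (r x * V x))) (at x)"
      if "x \<in> {0<..<L}" for x
      using u'[of x] that by (simp add: at_within_Icc_at)
  qed (use u angle_0[OF assms] in auto)
  then show ?thesis using r_pos by (intro exI[of _ r]) (auto simp: r_def)
qed

text \<open>The nodal domains are the preimages of the intervals between consecutive multiples of \<open>\<pi>\<close> under the increasing
angle function.\<close>

lemma card_nodal_domains_angle:
  assumes "0 < lam" and end_: "angle lam L = real k * pi"
    and u: "\<And>x. x \<in> {0..L} \<Longrightarrow> u x \<noteq> 0 \<longleftrightarrow> sin (angle lam x) \<noteq> 0"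
  shows "card (nodal_domains L u) = k"
proof -
  let ?y = "angle lam"
  define S where "S = {x \<in> {0<..<L}. u x \<noteq> 0}"
  define I where "I j = {x \<in> {0<..<L}. real j * pi < ?y x \<and> ?y x < real (Suc j) * pi}" for j
  have y: "is_angle lam ?y" using assms by (intro is_angle_angle) auto
  have yc: "continuous_on {0..L} ?y" by (rule is_angle_continuous[OF y])
  have y0: "?y 0 = 0" using angle_0 assms by auto
  have mono: "?y a < ?y b" if "0 \<le> a" "a < b" "b \<le> L" for a b
    using angle_strictly_increasing assms that by auto
  have S_iff: "x \<in> S \<longleftrightarrow> x \<in> {0<..<L} \<and> (\<forall>j::int. ?y x \<noteq> of_int j * pi)" for x
    using u[of x] by (auto simp: S_def sin_zero_iff_int2)
  have I_ne: "\<exists>x. x \<in> I j" if "j < k" for j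
  proof -
    have "real j + 1 / 2 < real k" using that by (simp add: nat_less_real_le)
    then have v: "(real j + 1 / 2) * pi < real k * pi" by (intro mult_strict_right_mono) auto
    have v0: "0 < (real j + 1 / 2) * pi" by (intro mult_pos_pos) auto
    obtain x where x: "0 \<le> x" "x \<le> L" "?y x = (real j + 1 / 2) * pi"
      using IVT'[of ?y 0 "(real j + 1 / 2) * pi" L] y0 end_ v v0 L_pos yc by auto
    then have "x \<noteq> 0" "x \<noteq> L" using y0 end_ v v0 by auto
    then have "x \<in> I j" using x by (auto simp: I_def algebra_simps)
    then show ?thesis by blast
  qed
  have I_S: "I j \<subseteq> S" for j
  proof
    fix x assume x: "x \<in> I j"
    have "?y x \<noteq> of_int i * pi" for i :: int
    proof
      assume *: "?y x = of_int i * pi"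
      then have "real j < of_int i" "of_int i < real (Suc j)"
        using x pi_gt_zero by (auto simp: I_def)
      then have "int j < i" "i < int (Suc j)" by linarith+
      then show False by linarith
    qed
    then show "x \<in> S" using x by (auto simp: S_iff I_def)
  qed
  have S_I: "\<exists>j<k. x \<in> I j" if "x \<in> S" for x
  proof -
    have x: "0 < x" "x < L" and ne: "\<And>j::int. ?y x \<noteq> of_int j * pi" using that by (auto simp: S_iff)
    have b: "0 < ?y x" "?y x < real k * pi" using mono[of 0 x] mono[of x L] x y0 end_ by auto
    define j where "j = nat \<lfloor>?y x / pi\<rfloor>"
    have j: "real j = of_int \<lfloor>?y x / pi\<rfloor>" using b by (simp add: j_def)
    have "real j \<le> ?y x / pi" "?y x / pi < real j + 1" unfolding j by linarith+
    then have "real j * pi \<le> ?y x" "?y x < real (Suc j) * pi" by (auto simp: field_simps)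
    moreover have "?y x \<noteq> real j * pi" using ne[of "int j"] by simp
    moreover have "j < k"
    proof -
      have "real j * pi < real k * pi" using calculation b by linarith
      then show ?thesis by simp
    qed
    ultimately show ?thesis using x by (auto simp: I_def intro!: exI[of _ j])
  qed
  have comp: "connected_component_set S x = I j" if x: "x \<in> I j" for x j
  proof (rule connected_component_unique[OF x I_S])
    have "is_interval (I j)"
      unfolding is_interval_1
    proof (intro ballI allI impI, elim conjE)
      fix a b z assume a: "a \<in> I j" and b: "b \<in> I j" and z: "a \<le> z" "z \<le> b"
      have "?y a \<le> ?y z" "?y z \<le> ?y b"
        using mono[of a z] mono[of z b] a b z by (cases "a = z"; cases "z = b"; auto simp: I_def)+
      then show "z \<in> I j" using a b z by (auto simp: I_def)
    qed
    then show "connected (I j)" by (rule is_interval_connected)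
    fix c' assume c': "x \<in> c'" "c' \<subseteq> S" "connected c'"
    have "connected (?y ` c')"
      using c' by (intro connected_continuous_image continuous_on_subset[OF yc]) (auto simp: S_def)
    then have Icc: "{?y a..?y b} \<subseteq> ?y ` c'" if "a \<in> c'" "b \<in> c'" for a b
      using that by (intro connected_contains_Icc) auto
    have avoid: "real i * pi \<notin> ?y ` c'" for i :: nat
      using c'(2) S_iff by (auto dest!: subsetD) (metis of_int_of_nat_eq)
    show "c' \<subseteq> I j"
    proof
      fix z assume z: "z \<in> c'"
      have "real j * pi \<notin> {?y z..?y x}" using Icc[OF z c'(1)] avoid[of j] by blast
      then have "\<not> ?y z \<le> real j * pi" using x by (simp add: I_def)
      moreover have "real (Suc j) * pi \<notin> {?y x..?y z}" using Icc[OF c'(1) z] avoid[of "Suc j"] by blast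
      then have "\<not> real (Suc j) * pi \<le> ?y z" using x by (simp add: I_def)
      ultimately show "z \<in> I j" using z c'(2) S_iff by (auto simp: I_def)
    qed
  qed
  have "components S = I ` {..<k}"
  proof (intro set_eqI iffI)
    fix X assume "X \<in> components S"
    then obtain x where "x \<in> S" "X = connected_component_set S x" by (auto simp: components_def)
    then show "X \<in> I ` {..<k}" using S_I[of x] comp by auto
  next
    fix X assume "X \<in> I ` {..<k}"
    then obtain j where j: "j < k" "X = I j" by auto
    then obtain x where "x \<in> I j" using I_ne by blast
    then show "X \<in> components S" using comp[of x j] I_S j by (auto simp: components_def)
  qed
  moreover have "inj_on I {..<k}"
  proof (rule inj_onI)
    fix i j assume "i \<in> {..<k}" "j \<in> {..<k}" "I i = I j"
    then obtain x where "x \<in> I i" "x \<in> I j" using I_ne by blast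
    then have "real i * pi < real (Suc j) * pi" "real j * pi < real (Suc i) * pi"
      unfolding I_def mem_Collect_eq by linarith+
    then have "real i < real (Suc j)" "real j < real (Suc i)" by auto
    then show "i = j" by linarith
  qed
  ultimately show ?thesis unfolding nodal_domains_def S_def[symmetric] by (simp add: card_image)
qed

text \<open>By uniqueness and positive homogeneity, every solution with \<open>u' 0 > 0\<close> is a positive multiple of the one built from
the angle. Its condition at \<open>L\<close> says that the end angle is a multiple of \<open>\<pi>\<close>, and the multiple is the number
of nodal domains.\<close>

lemma eigenvalue_condition_iff:
  assumes "0 < lam"
  shows "(\<exists>u u'. solves_problem p q 1 L lam u u' \<and> (\<exists>x\<in>{0..L}. u x \<noteq> 0) \<and>
      card (nodal_domains L u) = k \<and> u' 0 > 0) \<longleftrightarrow> angle lam L = real k * pi"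
proof -
  obtain r where r: "\<And>x. 0 < r x" "r 0 = 1"
    and ivp: "solves_ivp lam (\<lambda>x. r x * sin (angle lam x)) (\<lambda>x. r x * cos (angle lam x))"
    using solves_ivp_from_angle[of lam] assms by auto
  have a0: "angle lam 0 = 0" using angle_0 assms by auto
  have aL: "0 < angle lam L" using angle_strictly_increasing[OF assms, of 0 L] L_pos a0 by simp
  show ?thesis
  proof
    assume "\<exists>u u'. solves_problem p q 1 L lam u u' \<and> (\<exists>x\<in>{0..L}. u x \<noteq> 0) \<and>
      card (nodal_domains L u) = k \<and> u' 0 > 0"
    then obtain u u' where u: "solves_ivp lam u u'" "u L = 0" "card (nodal_domains L u) = k" "u' 0 > 0"
      by (auto simp: solves_problem_iff_ivp)
    have eq: "u x = u' 0 * (r x * sin (angle lam x))" if "x \<in> {0..L}" for x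
      using solves_ivp_unique[OF u(1) solves_ivp_scale[OF ivp u(4)] _ _ that] assms r a0 by simp
    have nz: "u x \<noteq> 0 \<longleftrightarrow> sin (angle lam x) \<noteq> 0" if "x \<in> {0..L}" for x
      using eq[OF that] u(4) r(1)[of x] by auto
    have "sin (angle lam L) = 0" using nz[of L] u(2) L_pos by auto
    then obtain i :: int where i: "angle lam L = of_int i * pi" by (auto simp: sin_zero_iff_int2)
    then have "0 < i" using aL by (simp add: zero_less_mult_iff)
    then have i': "angle lam L = real (nat i) * pi" using i by simp
    then have "card (nodal_domains L u) = nat i"
      using card_nodal_domains_angle[OF assms _ nz] by blast
    then show "angle lam L = real k * pi" using u(3) i' by simp
  next
    assume k: "angle lam L = real k * pi"
    let ?u = "\<lambda>x. r x * sin (angle lam x)" and ?u' = "\<lambda>x. r x * cos (angle lam x)"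
    have nz: "?u x \<noteq> 0 \<longleftrightarrow> sin (angle lam x) \<noteq> 0" for x using r(1)[of x] by auto
    have card: "card (nodal_domains L ?u) = k"
      by (rule card_nodal_domains_angle[OF assms k nz])
    moreover have "k \<noteq> 0" using k aL by (intro notI) simp
    ultimately have "nodal_domains L ?u \<noteq> {}" by auto
    then have "\<exists>x\<in>{0..L}. ?u x \<noteq> 0"
      by (auto simp: nodal_domains_def components_def intro: less_imp_le)
    moreover have "solves_problem p q 1 L lam ?u ?u'" using ivp k by (simp add: solves_problem_iff_ivp)
    ultimately show "\<exists>u u'. solves_problem p q 1 L lam u u' \<and> (\<exists>x\<in>{0..L}. u x \<noteq> 0) \<and>
      card (nodal_domains L u) = k \<and> u' 0 > 0"
      using card r a0 by (intro exI[of _ ?u] exI[of _ ?u']) auto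
  qed
qed

section \<open>Counting eigenvalues by the angle\<close>

lemma eigenvalue_plus_le_iff:
  assumes "1 \<le> k" "0 < lam"
  shows "eigenvalue_plus p q 1 L k \<le> lam \<longleftrightarrow> real k * pi \<le> angle lam L"
proof -
  have "eigenvalue_plus p q 1 L k = (THE lam. 0 < lam \<and> angle lam L = real k * pi)"
    unfolding eigenvalue_plus_def
    by (rule arg_cong[where f = The], rule ext) (use eigenvalue_condition_iff in blast)
  then have "0 < eigenvalue_plus p q 1 L k \<and> angle (eigenvalue_plus p q 1 L k) L = real k * pi"
    using theI'[OF angle_attains[OF assms(1)]] by simp
  then show ?thesis
    using angle_strict_mono[of lam "eigenvalue_plus p q 1 L k"]
      angle_strict_mono[of "eigenvalue_plus p q 1 L k" lam] assms(2)
    by (cases "eigenvalue_plus p q 1 L k" lam rule: linorder_cases) auto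
qed

lemma card_eigenvalue_plus_le:
  assumes "0 < lam"
  shows "\<bar>real (card {k. k \<ge> 1 \<and> eigenvalue_plus p q 1 L k \<le> lam}) - angle lam L / pi\<bar> \<le> 1"
proof -
  have a: "0 \<le> angle lam L"
    using angle_strictly_increasing[OF assms, of 0 L] L_pos angle_0 assms by simp
  have "{k. k \<ge> 1 \<and> eigenvalue_plus p q 1 L k \<le> lam} = {k. 1 \<le> k \<and> real k * pi \<le> angle lam L}"
    using eigenvalue_plus_le_iff assms by auto
  also have "\<dots> = {1..nat \<lfloor>angle lam L / pi\<rfloor>}"
  proof -
    have "real k * pi \<le> angle lam L \<longleftrightarrow> k \<le> nat \<lfloor>angle lam L / pi\<rfloor>" for k
    proof -
      have "real k * pi \<le> angle lam L \<longleftrightarrow> of_int (int k) \<le> angle lam L / pi"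
        by (simp add: field_simps)
      also have "\<dots> \<longleftrightarrow> int k \<le> \<lfloor>angle lam L / pi\<rfloor>"
        by (rule le_floor_iff[symmetric])
      also have "\<dots> \<longleftrightarrow> k \<le> nat \<lfloor>angle lam L / pi\<rfloor>"
        using a by (simp add: le_nat_iff)
      finally show ?thesis .
    qed
    then show ?thesis by (intro set_eqI) (simp only: mem_Collect_eq atLeastAtMost_iff)
  qed
  finally have "real (card {k. k \<ge> 1 \<and> eigenvalue_plus p q 1 L k \<le> lam}) = of_int \<lfloor>angle lam L / pi\<rfloor>"
    using a by (simp only: card_atLeastAtMost) simp
  then show ?thesis by linarith
qed

end

section \<open>The phase of the equation with frozen weights\<close>

text \<open>\<open>\<Psi>\<close> is the time that the angle equation with constant weights needs to reach a given angle, here with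
\<open>a\<^sup>2\<close> and \<open>b\<^sup>2\<close> in the role of \<open>lam p\<close> and \<open>lam q\<close>. On \<open>[0,\<pi>]\<close> and
\<open>[\<pi>,2\<pi>]\<close> it differs by a constant from an elliptic phase divided by \<open>a\<close> and by \<open>b\<close>, so it increases by
\<open>\<pi>/a + \<pi>/b = 2 \<pi> \<kappa>\<close> over a full period. Hence \<open>\<Psi> y - \<kappa> y\<close> is periodic and bounded.\<close>

lemma two_sided_phase:
  fixes a b :: real
  assumes "0 < a" "0 < b"
  defines "\<kappa> \<equiv> (1 / a + 1 / b) / 2"
  shows "\<exists>\<Psi>. (\<forall>y\<ge>0. (\<Psi> has_real_derivative
      1 / ((cos y)\<^sup>2 + (a\<^sup>2 * (max 0 (sin y))\<^sup>2 + b\<^sup>2 * (max 0 (- sin y))\<^sup>2))) (at y)) \<and>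
    (\<forall>y\<ge>0. \<forall>z\<ge>0. \<bar>\<Psi> y - \<Psi> z - \<kappa> * (y - z)\<bar> \<le> 4 * pi * \<kappa>)"
proof -
  define Q where "Q y = (cos y)\<^sup>2 + (a\<^sup>2 * (max 0 (sin y))\<^sup>2 + b\<^sup>2 * (max 0 (- sin y))\<^sup>2)" for y :: real
  have Q_upper: "Q y = (cos y)\<^sup>2 + a\<^sup>2 * (sin y)\<^sup>2" if "0 \<le> sin y" for y
    using that by (simp add: Q_def max_def)
  have Q_lower: "Q y = (cos y)\<^sup>2 + b\<^sup>2 * (sin y)\<^sup>2" if "sin y \<le> 0" for y
    using that by (simp add: Q_def max_def)
  have Q_pos: "0 < Q y" for y
    using Q_upper[of y] Q_lower[of y] elliptic_form_pos[of "a\<^sup>2" y] elliptic_form_pos[of "b\<^sup>2" y] assms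
    by (cases "0 \<le> sin y") auto
  have \<kappa>: "0 < \<kappa>" using assms by (simp add: \<kappa>_def add_pos_pos)
  \<comment> \<open>The lower limit \<open>-1\<close> makes every \<open>y \<ge> 0\<close> an interior point, so that \<open>\<Psi>\<close> has a
    two-sided derivative there.\<close>
  define \<Psi> where "\<Psi> y = integral {-1..y} (\<lambda>y. 1 / Q y)" for y
  have cont: "continuous_on S (\<lambda>y. 1 / Q y)" for S
  proof (rule continuous_on_divide)
    show "continuous_on S Q" unfolding Q_def by (intro continuous_intros)
    show "\<forall>y\<in>S. Q y \<noteq> 0" using Q_pos less_irrefl by metis
  qed (rule continuous_on_const)
  have \<Psi>: "(\<Psi> has_real_derivative 1 / Q y) (at y)" if "0 \<le> y" for y
  proof -
    have "(\<Psi> has_real_derivative 1 / Q y) (at y within {-1..y+1})"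
      unfolding \<Psi>_def using that by (intro integral_has_real_derivative cont) auto
    then show ?thesis using that by (simp add: at_within_Icc_at)
  qed
  have \<Psi>_cont: "continuous_on {y..z} \<Psi>" if "0 \<le> y" for y z
    using DERIV_isCont[OF \<Psi>] that by (intro continuous_at_imp_continuous_on) auto
  have \<Psi>_mono: "\<Psi> y \<le> \<Psi> z" if "0 \<le> y" "y \<le> z" for y z
  proof (rule DERIV_nonneg_imp_increasing_open[OF that(2) _ \<Psi>_cont[OF that(1)]])
    fix x assume "y < x" "x < z"
    then show "\<exists>d. (\<Psi> has_real_derivative d) (at x) \<and> 0 \<le> d"
      using \<Psi>[of x] Q_pos[of x] that by (intro exI[of _ "1 / Q x"]) auto
  qed
  have half: "\<Psi> z - \<Psi> y = (elliptic_phase e z - elliptic_phase e y) / e"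
    if "0 < e" "0 \<le> y" "y < z" and Q: "\<And>x. y < x \<Longrightarrow> x < z \<Longrightarrow> Q x = (cos x)\<^sup>2 + e\<^sup>2 * (sin x)\<^sup>2" for e y z
  proof -
    let ?g = "\<lambda>x. \<Psi> x - elliptic_phase e x / e"
    have "?g z = ?g y"
    proof (rule DERIV_isconst_end[OF \<open>y < z\<close>])
      have "continuous_on {y..z} (elliptic_phase e)"
        using DERIV_isCont[OF elliptic_phase_deriv[OF \<open>0 < e\<close>]] by (intro continuous_at_imp_continuous_on) auto
      then show "continuous_on {y..z} ?g"
        using \<Psi>_cont[OF that(2)] that(1) by (intro continuous_intros) auto
      fix x assume x: "y < x" "x < z"
      have "(?g has_real_derivative 1 / Q x - e / Q x / e) (at x)"
        using \<Psi>[of x] elliptic_phase_deriv[OF \<open>0 < e\<close>, of x] that x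
        by (intro DERIV_diff DERIV_cdivide) auto
      then show "(?g has_real_derivative 0) (at x)" using \<open>0 < e\<close> by simp
    qed
    then show ?thesis by (simp add: diff_divide_distrib)
  qed
  have "\<Psi> pi - \<Psi> 0 = pi / a"
    using half[of a 0 pi] assms(1) Q_upper sin_ge_zero by simp
  moreover have "\<Psi> (2 * pi) - \<Psi> pi = pi / b"
    using half[of b pi "2 * pi"] assms(2) Q_lower sin_le_zero by simp
  ultimately have period0: "\<Psi> (2 * pi) - \<Psi> 0 = 2 * pi * \<kappa>"
    by (simp add: \<kappa>_def field_simps)
  have period: "\<Psi> (y + 2 * pi) - \<Psi> y = 2 * pi * \<kappa>" if "0 \<le> y" for y
  proof (cases "y = 0")
    case False
    have "\<Psi> (y + 2 * pi) - \<Psi> y = \<Psi> (0 + 2 * pi) - \<Psi> 0"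
    proof (rule DERIV_isconst_end[where f = "\<lambda>x. \<Psi> (x + 2 * pi) - \<Psi> x"])
      have "continuous_on {0..y} (\<lambda>x. \<Psi> (x + 2 * pi))"
        by (rule continuous_on_compose2[OF \<Psi>_cont[of "2 * pi" "y + 2 * pi"]])
           (auto intro!: continuous_intros)
      then show "continuous_on {0..y} (\<lambda>x. \<Psi> (x + 2 * pi) - \<Psi> x)"
        using \<Psi>_cont[of 0 y] by (intro continuous_intros) auto
      fix x assume "0 < x" "x < y"
      then have "((\<lambda>x. \<Psi> (x + 2 * pi) - \<Psi> x) has_real_derivative 1 / Q (x + 2 * pi) - 1 / Q x) (at x)"
        using \<Psi>[of "x + 2 * pi"] \<Psi>[of x] by (intro DERIV_diff) (auto simp: DERIV_shift)
      then show "((\<lambda>x. \<Psi> (x + 2 * pi) - \<Psi> x) has_real_derivative 0) (at x)"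
        by (simp add: Q_def)
    qed (use False that in auto)
    then show ?thesis using period0 by simp
  qed (use period0 in simp)
  define E where "E y = \<Psi> y - \<kappa> * y" for y
  have E_period: "E (y + real n * (2 * pi)) = E y" if "0 \<le> y" for y n
  proof (induction n)
    case (Suc n)
    have "0 \<le> y + real n * (2 * pi)" using that by simp
    from period[OF this] Suc show ?case by (simp add: E_def algebra_simps)
  qed simp
  have E_bound: "\<bar>E y - \<Psi> 0\<bar> \<le> 2 * pi * \<kappa>" if "0 \<le> y" for y
  proof -
    define n where "n = nat \<lfloor>y / (2 * pi)\<rfloor>"
    define z where "z = y - real n * (2 * pi)"
    have "real n = of_int \<lfloor>y / (2 * pi)\<rfloor>" using that by (simp add: n_def)
    then have "real n \<le> y / (2 * pi)" "y / (2 * pi) < real n + 1" by linarith+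
    then have "real n * (2 * pi) \<le> y" "y < (real n + 1) * (2 * pi)"
      by (simp_all add: pos_le_divide_eq pos_divide_less_eq)
    then have z: "0 \<le> z" "z \<le> 2 * pi" by (simp_all add: z_def algebra_simps)
    have "E y = E z" using E_period[OF z(1), of n] by (simp add: z_def)
    moreover have "\<Psi> 0 \<le> \<Psi> z" "\<Psi> z \<le> \<Psi> (2 * pi)" using z \<Psi>_mono by auto
    moreover have "0 \<le> \<kappa> * z" "\<kappa> * z \<le> \<kappa> * (2 * pi)" using z \<kappa> by (auto intro: mult_left_mono)
    ultimately show ?thesis using period0 by (simp add: E_def abs_le_iff algebra_simps)
  qed
  have "\<bar>\<Psi> y - \<Psi> z - \<kappa> * (y - z)\<bar> \<le> 4 * pi * \<kappa>" if "0 \<le> y" "0 \<le> z" for y z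
    using E_bound[OF that(1)] E_bound[OF that(2)] unfolding E_def right_diff_distrib by linarith
  then show ?thesis using \<Psi> unfolding Q_def by blast
qed

context weights
begin

text \<open>For constant weights, a positive and a negative nodal domain have lengths \<open>\<pi> / sqrt (lam p)\<close> and
\<open>\<pi> / sqrt (lam q)\<close>, together \<open>\<pi> / (sqrt lam weight_mean)\<close>. So the angle grows by \<open>2 \<pi>\<close> over this
length.\<close>

definition weight_mean :: "real \<Rightarrow> real" where
  "weight_mean x = inverse (1 / sqrt (p x) + 1 / sqrt (q x))"

definition weight_oscillation :: "real \<Rightarrow> real \<Rightarrow> real" where
  "weight_oscillation \<xi> x = \<bar>p x - p \<xi>\<bar> + \<bar>q x - q \<xi>\<bar>"

lemma weight_oscillation_continuous: "continuous_on {0..L} (weight_oscillation \<xi>)"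
  unfolding weight_oscillation_def by (intro continuous_intros p_cont q_cont)

lemma weight_mean_bounds:
  assumes "x \<in> {0..L}"
  shows "0 < weight_mean x" "weight_mean x \<le> sqrt C"
proof -
  have p: "0 < p x" "p x \<le> C" and q: "0 < q x"
    using p_bounds[OF assms] q_bounds[OF assms] c_pos by auto
  then show "0 < weight_mean x" by (simp add: weight_mean_def add_pos_pos)
  have "1 / sqrt C \<le> 1 / sqrt (p x)" using p by (intro divide_left_mono) auto
  also have "\<dots> \<le> 1 / sqrt (p x) + 1 / sqrt (q x)" using q by simp
  finally have "weight_mean x \<le> inverse (1 / sqrt C)"
    unfolding weight_mean_def using C_pos by (intro le_imp_inverse_le) auto
  then show "weight_mean x \<le> sqrt C" by simp
qed

lemma weight_mean_continuous: "continuous_on {0..L} weight_mean"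
proof -
  have "0 < p x" "0 < q x" if "x \<in> {0..L}" for x
    using p_bounds[OF that] q_bounds[OF that] c_pos by auto
  moreover from this have "0 < 1 / sqrt (p x) + 1 / sqrt (q x)" if "x \<in> {0..L}" for x
    using that by (intro add_pos_pos) auto
  ultimately show ?thesis
    unfolding weight_mean_def by (intro continuous_intros p_cont q_cont) fastforce+
qed

text \<open>Both the change of the potential and the lower bound \<open>lam c (sin y)\<^sup>2\<close> for the field carry the factor
\<open>lam (sin y)\<^sup>2\<close>. This is why the relative error of freezing is bounded uniformly in \<open>lam\<close> and \<open>y\<close>.\<close>

lemma angle_field_frozen:
  assumes x: "x \<in> {0..L}" and \<xi>: "\<xi> \<in> {0..L}" and lam: "0 < lam"
  shows "\<bar>angle_field lam x y / angle_field lam \<xi> y - 1\<bar> \<le> weight_oscillation \<xi> x / c"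
proof -
  let ?o = "weight_oscillation \<xi> x"
  have F: "(cos y)\<^sup>2 + lam * c * (sin y)\<^sup>2 \<le> angle_field lam \<xi> y"
    using angle_field_ge[OF \<xi>] lam by simp
  have F_pos: "0 < angle_field lam \<xi> y"
    using elliptic_form_pos[of "lam * c" y] lam c_pos F by (auto intro: less_le_trans)
  have "potential x y - potential \<xi> y
      = (p x - p \<xi>) * (max 0 (sin y))\<^sup>2 + (q x - q \<xi>) * (max 0 (- sin y))\<^sup>2"
    by (simp add: potential_def algebra_simps)
  also have "\<bar>\<dots>\<bar> \<le> \<bar>p x - p \<xi>\<bar> * (max 0 (sin y))\<^sup>2 + \<bar>q x - q \<xi>\<bar> * (max 0 (- sin y))\<^sup>2"
    using abs_triangle_ineq[of "(p x - p \<xi>) * (max 0 (sin y))\<^sup>2" "(q x - q \<xi>) * (max 0 (- sin y))\<^sup>2"]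
    by (simp add: abs_mult)
  also have "\<dots> \<le> ?o * (max 0 (sin y))\<^sup>2 + ?o * (max 0 (- sin y))\<^sup>2"
    by (intro add_mono mult_right_mono) (auto simp: weight_oscillation_def)
  also have "\<dots> = ?o * (sin y)\<^sup>2"
    unfolding max_sin_sum[symmetric] by (simp add: distrib_left)
  finally have "lam * \<bar>potential x y - potential \<xi> y\<bar> \<le> lam * (?o * (sin y)\<^sup>2)"
    using lam by (intro mult_left_mono) auto
  also have "\<dots> = ?o / c * (lam * c * (sin y)\<^sup>2)" using c_pos by simp
  also have "\<dots> \<le> ?o / c * angle_field lam \<xi> y"
  proof (rule mult_left_mono)
    show "lam * c * (sin y)\<^sup>2 \<le> angle_field lam \<xi> y"
      using F zero_le_power2[of "cos y"] by linarith
  qed (use c_pos in \<open>simp add: weight_oscillation_def\<close>)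
  finally have *: "lam * \<bar>potential x y - potential \<xi> y\<bar> \<le> ?o / c * angle_field lam \<xi> y" .
  have "angle_field lam x y / angle_field lam \<xi> y - 1
      = lam * (potential x y - potential \<xi> y) / angle_field lam \<xi> y"
    using F_pos by (simp add: angle_field_def field_simps)
  also have "\<bar>\<dots>\<bar> = lam * \<bar>potential x y - potential \<xi> y\<bar> / angle_field lam \<xi> y"
    using F_pos lam by (simp add: abs_mult)
  also have "\<dots> \<le> ?o / c"
    using * F_pos by (simp add: pos_divide_le_eq)
  finally show ?thesis .
qed

text \<open>The phase of the angle moves with speed \<open>1\<close> up to the relative error of the frozen field, and it follows the linear
function of slope \<open>\<kappa> = 1 / (2 sqrt lam weight_mean \<xi>)\<close> up to \<open>4 \<pi> \<kappa>\<close>. Dividing by \<open>\<kappa>\<close> turns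
the latter into the error \<open>4 \<pi>\<close>, which depends neither on \<open>lam\<close> nor on the length of the interval.\<close>

lemma angle_increment_frozen:
  assumes ab: "0 \<le> a" "a \<le> b" "b \<le> L" and \<xi>: "\<xi> \<in> {0..L}" and lam: "0 < lam"
  shows "\<bar>angle lam b - angle lam a - 2 * sqrt lam * weight_mean \<xi> * (b - a)\<bar>
    \<le> 4 * pi + 2 * sqrt lam * sqrt C / c * integral {a..b} (weight_oscillation \<xi>)"
proof -
  let ?y = "angle lam" and ?I = "integral {a..b} (weight_oscillation \<xi>)"
  define \<alpha> \<beta> where "\<alpha> = sqrt (lam * p \<xi>)" and "\<beta> = sqrt (lam * q \<xi>)"
  have pq: "0 < p \<xi>" "0 < q \<xi>" using p_bounds[OF \<xi>] q_bounds[OF \<xi>] c_pos by auto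
  then have pos: "0 < \<alpha>" "0 < \<beta>" using lam by (auto simp: \<alpha>_def \<beta>_def)
  define \<kappa> where "\<kappa> = (1 / \<alpha> + 1 / \<beta>) / 2"
  have \<kappa>: "0 < \<kappa>" using pos by (simp add: \<kappa>_def add_pos_pos)
  have \<kappa>_inv: "2 * sqrt lam * weight_mean \<xi> = 1 / \<kappa>"
    using pq lam unfolding \<kappa>_def weight_mean_def \<alpha>_def \<beta>_def real_sqrt_mult
    by (simp add: field_simps add_eq_0_iff)
  have field: "(cos y)\<^sup>2 + (\<alpha>\<^sup>2 * (max 0 (sin y))\<^sup>2 + \<beta>\<^sup>2 * (max 0 (- sin y))\<^sup>2) = angle_field lam \<xi> y" for y
    using pq lam by (simp add: \<alpha>_def \<beta>_def angle_field_def potential_def distrib_left mult.assoc)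
  obtain \<Psi> where \<Psi>: "\<And>y. 0 \<le> y \<Longrightarrow> (\<Psi> has_real_derivative 1 / angle_field lam \<xi> y) (at y)"
    and near: "\<And>y z. 0 \<le> y \<Longrightarrow> 0 \<le> z \<Longrightarrow> \<bar>\<Psi> y - \<Psi> z - \<kappa> * (y - z)\<bar> \<le> 4 * pi * \<kappa>"
    using two_sided_phase[OF pos] unfolding field \<kappa>_def by blast
  have y: "is_angle lam ?y" using lam by (intro is_angle_angle) auto
  have y_nonneg: "0 \<le> ?y x" if "x \<in> {0..L}" for x
    using angle_strictly_increasing[OF lam, of 0 x] angle_0[of lam] lam that by (cases "x = 0") auto
  let ?f = "\<lambda>x. angle_field lam x (?y x) / angle_field lam \<xi> (?y x) - 1"
  have int: "(?f has_integral (\<Psi> (?y b) - b) - (\<Psi> (?y a) - a)) {a..b}"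
  proof (rule fundamental_theorem_of_calculus[OF ab(2)])
    fix x assume x: "x \<in> {a..b}"
    then have xL: "x \<in> {0..L}" using ab by auto
    have "(?y has_real_derivative angle_field lam x (?y x)) (at x within {a..b})"
      using y xL ab unfolding is_angle_def
      by (metis atLeastatMost_subset_iff has_field_derivative_subset)
    then have "((\<lambda>x. \<Psi> (?y x)) has_real_derivative 1 / angle_field lam \<xi> (?y x) * angle_field lam x (?y x))
        (at x within {a..b})"
      by (rule DERIV_chain2[where f = \<Psi> and g = ?y, OF \<Psi>[OF y_nonneg[OF xL]]])
    then have "((\<lambda>x. \<Psi> (?y x) - x) has_real_derivative 1 / angle_field lam \<xi> (?y x) * angle_field lam x (?y x) - 1)
        (at x within {a..b})"
      by (intro DERIV_diff DERIV_ident)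
    then show "((\<lambda>x. \<Psi> (?y x) - x) has_vector_derivative ?f x) (at x within {a..b})"
      by (simp add: has_real_derivative_iff_has_vector_derivative)
  qed
  have "norm (integral {a..b} ?f) \<le> integral {a..b} (\<lambda>x. weight_oscillation \<xi> x / c)"
  proof (rule integral_norm_bound_integral)
    show "(\<lambda>x. weight_oscillation \<xi> x / c) integrable_on {a..b}"
      using continuous_on_subset[OF weight_oscillation_continuous, of "{a..b}"] ab c_pos
      by (intro integrable_continuous_interval continuous_intros) auto
    show "norm (?f x) \<le> weight_oscillation \<xi> x / c" if "x \<in> {a..b}" for x
      using angle_field_frozen[OF _ \<xi> lam, of x "?y x"] that ab by auto
  qed (use int in blast)
  then have "\<bar>\<Psi> (?y b) - \<Psi> (?y a) - (b - a)\<bar> \<le> ?I / c"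
    using int by (simp add: integral_unique algebra_simps)
  moreover have "\<bar>\<Psi> (?y b) - \<Psi> (?y a) - \<kappa> * (?y b - ?y a)\<bar> \<le> 4 * pi * \<kappa>"
    using near y_nonneg ab by auto
  ultimately have "\<bar>\<kappa> * (?y b - ?y a) - (b - a)\<bar> \<le> 4 * pi * \<kappa> + ?I / c" by linarith
  then have "\<bar>\<kappa> * (?y b - ?y a) - (b - a)\<bar> / \<kappa> \<le> (4 * pi * \<kappa> + ?I / c) / \<kappa>"
    using \<kappa> by (intro divide_right_mono) auto
  moreover have "\<bar>\<kappa> * (?y b - ?y a) - (b - a)\<bar> / \<kappa> = \<bar>?y b - ?y a - 1 / \<kappa> * (b - a)\<bar>"
    using \<kappa> by (simp add: abs_divide[of _ \<kappa>, symmetric, unfolded abs_of_pos[OF \<kappa>]] diff_divide_distrib)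
  ultimately have "\<bar>?y b - ?y a - 1 / \<kappa> * (b - a)\<bar> \<le> 4 * pi + 1 / \<kappa> * (?I / c)"
    using \<kappa> by (simp add: add_divide_distrib mult.commute[of c])
  also have "1 / \<kappa> * (?I / c) \<le> 2 * sqrt lam * sqrt C * (?I / c)"
  proof (rule mult_right_mono)
    show "1 / \<kappa> \<le> 2 * sqrt lam * sqrt C"
      unfolding \<kappa>_inv[symmetric] using weight_mean_bounds[OF \<xi>] lam by (intro mult_left_mono) auto
    have "0 \<le> ?I"
      by (rule integral_nonneg)
         (use continuous_on_subset[OF weight_oscillation_continuous, of "{a..b}"] ab in
           \<open>auto intro!: integrable_continuous_interval simp: weight_oscillation_def\<close>)
    then show "0 \<le> ?I / c" using c_pos by simp
  qed
  finally show ?thesis unfolding \<kappa>_inv by simp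
qed

lemma angle_increment:
  assumes ab: "0 \<le> a" "a < b" "b \<le> L" and lam: "0 < lam" and \<xi>: "\<xi> \<in> {0..L}"
    and osc: "integral {a..b} (\<lambda>x. weight_oscillation \<xi> x + \<bar>weight_mean x - weight_mean \<xi>\<bar>) \<le> B"
  shows "\<bar>angle lam b - angle lam a - 2 * sqrt lam * integral {a..b} weight_mean\<bar>
    \<le> 4 * pi + 2 * sqrt lam * (sqrt C / c + 1) * B"
proof -
  let ?H = weight_mean
  let ?I = "integral {a..b} (weight_oscillation \<xi>)" and ?J = "integral {a..b} (\<lambda>x. \<bar>?H x - ?H \<xi>\<bar>)"
  have sub: "{a..b} \<subseteq> {0..L}" using ab by auto
  have i: "weight_oscillation \<xi> integrable_on {a..b}"
    by (intro integrable_continuous_interval continuous_on_subset[OF weight_oscillation_continuous sub])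
  have h: "?H integrable_on {a..b}"
    by (intro integrable_continuous_interval continuous_on_subset[OF weight_mean_continuous sub])
  have j: "(\<lambda>x. \<bar>?H x - ?H \<xi>\<bar>) integrable_on {a..b}"
    by (intro integrable_continuous_interval continuous_intros continuous_on_subset[OF weight_mean_continuous sub])
  have IJ: "?I + ?J \<le> B" using osc by (simp add: integral_add i j)
  have I: "0 \<le> ?I" by (rule integral_nonneg[OF i]) (auto simp: weight_oscillation_def)
  have J: "0 \<le> ?J" by (rule integral_nonneg[OF j]) auto
  have "integral {a..b} ?H - ?H \<xi> * (b - a) = integral {a..b} (\<lambda>x. ?H x - ?H \<xi>)"
    using ab h by (subst integral_diff) (auto simp: mult.commute)
  also have "norm \<dots> \<le> ?J"
    by (rule integral_norm_bound_integral) (use h j in \<open>auto intro: integrable_diff\<close>)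
  finally have "2 * sqrt lam * \<bar>integral {a..b} ?H - ?H \<xi> * (b - a)\<bar> \<le> 2 * sqrt lam * ?J"
    using lam by (intro mult_left_mono) auto
  moreover have "2 * sqrt lam * integral {a..b} ?H - 2 * sqrt lam * ?H \<xi> * (b - a)
      = 2 * sqrt lam * (integral {a..b} ?H - ?H \<xi> * (b - a))"
    by (simp add: algebra_simps)
  moreover have "\<bar>2 * sqrt lam * (integral {a..b} ?H - ?H \<xi> * (b - a))\<bar>
      = 2 * sqrt lam * \<bar>integral {a..b} ?H - ?H \<xi> * (b - a)\<bar>"
    using lam by (simp add: abs_mult)
  ultimately have "\<bar>angle lam b - angle lam a - 2 * sqrt lam * integral {a..b} ?H\<bar>
      \<le> 4 * pi + (2 * sqrt lam * sqrt C / c * ?I + 2 * sqrt lam * ?J)"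
    using angle_increment_frozen[OF ab(1) less_imp_le[OF ab(2)] ab(3) \<xi> lam] by linarith
  also have "2 * sqrt lam * sqrt C / c * ?I + 2 * sqrt lam * ?J = 2 * sqrt lam * (sqrt C / c * ?I + 1 * ?J)"
    by (simp add: algebra_simps)
  also have "\<dots> \<le> 2 * sqrt lam * ((sqrt C / c + 1) * ?I + (sqrt C / c + 1) * ?J)"
    using lam I J c_pos C_pos by (intro mult_left_mono add_mono mult_right_mono) auto
  also have "\<dots> = 2 * sqrt lam * (sqrt C / c + 1) * (?I + ?J)"
    by (simp add: algebra_simps)
  also have "\<dots> \<le> 2 * sqrt lam * (sqrt C / c + 1) * B"
    using IJ lam c_pos C_pos by (intro mult_left_mono) auto
  finally show ?thesis by simp
qed

section \<open>Asymptotics of the angle\<close>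

text \<open>Freezing at a point \<open>\<xi>\<close> of the interval, instead of replacing the weights by their averages, keeps the frozen weights
positive and their harmonic mean consistent with \<open>weight_mean \<xi>\<close>.\<close>

definition mean_oscillation_bound :: "real \<Rightarrow> real \<Rightarrow> bool" where
  "mean_oscillation_bound B \<gamma> \<longleftrightarrow> (\<forall>a b. 0 \<le> a \<longrightarrow> a < b \<longrightarrow> b \<le> L \<longrightarrow> (\<exists>\<xi>\<in>{a..b}.
     integral {a..b} (\<lambda>x. weight_oscillation \<xi> x + \<bar>weight_mean x - weight_mean \<xi>\<bar>) \<le> B * (b - a) powr \<gamma>))"

text \<open>The interval is cut into \<open>M\<close> equal pieces, each with an error \<open>O(1) + O(\<mu> (L / M) powr \<gamma>)\<close> where
\<open>\<mu> = sqrt lam\<close>. The sum \<open>O(M) + O(\<mu> M powr (1 - \<gamma>))\<close> is balanced by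
\<open>M powr \<gamma> = \<mu>\<close> up to rounding.\<close>

lemma angle_asymptotics:
  assumes osc: "mean_oscillation_bound B \<gamma>" and \<gamma>: "1 < \<gamma>" and lam: "1 \<le> lam"
  shows "\<bar>angle lam L - 2 * sqrt lam * integral {0..L} weight_mean\<bar>
    \<le> (8 * pi + 2 * (sqrt C / c + 1) * \<bar>B\<bar> * L powr \<gamma>) * lam powr (1 / \<gamma> / 2)"
proof -
  define \<mu> where "\<mu> = sqrt lam"
  define N where "N = \<mu> powr (1 / \<gamma>)"
  define M where "M = nat \<lceil>N\<rceil>"
  have \<mu>: "1 \<le> \<mu>" using lam by (simp add: \<mu>_def)
  have N: "1 \<le> N" unfolding N_def using \<mu> \<gamma> by (intro ge_one_powr_ge_zero) auto
  have M: "N \<le> real M" "real M \<le> 2 * N" using N unfolding M_def by linarith+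
  have M_pos: "0 < real M" using N M by linarith
  define d where "d = L / real M"
  have d: "0 < d" "real M * d = L" using M_pos L_pos by (auto simp: d_def)
  define D where "D x = angle lam x - 2 * \<mu> * integral {0..x} weight_mean" for x
  define K where "K = sqrt C / c + 1"
  have K: "0 \<le> K" using c_pos C_pos by (simp add: K_def)
  have step: "\<bar>D (real (Suc i) * d) - D (real i * d)\<bar> \<le> 4 * pi + 2 * \<mu> * K * (\<bar>B\<bar> * d powr \<gamma>)" if "i < M" for i
  proof -
    let ?a = "real i * d" and ?b = "real (Suc i) * d"
    have "?b \<le> real M * d" using that d by (intro mult_right_mono) auto
    then have ab: "0 \<le> ?a" "?a < ?b" "?b \<le> L" using d by (auto simp: algebra_simps)
    have ba: "?b - ?a = d" by (simp add: algebra_simps)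
    obtain \<xi> where \<xi>: "\<xi> \<in> {?a..?b}"
      "integral {?a..?b} (\<lambda>x. weight_oscillation \<xi> x + \<bar>weight_mean x - weight_mean \<xi>\<bar>) \<le> B * (?b - ?a) powr \<gamma>"
      using osc ab unfolding mean_oscillation_bound_def by blast
    have "B * (?b - ?a) powr \<gamma> \<le> \<bar>B\<bar> * d powr \<gamma>" unfolding ba by (intro mult_right_mono) auto
    with \<xi> have "\<bar>angle lam ?b - angle lam ?a - 2 * sqrt lam * integral {?a..?b} weight_mean\<bar>
        \<le> 4 * pi + 2 * sqrt lam * K * (\<bar>B\<bar> * d powr \<gamma>)"
      unfolding K_def using ab lam by (intro angle_increment[where \<xi> = \<xi>]) (linarith | simp)+
    moreover have "integral {0..?a} weight_mean + integral {?a..?b} weight_mean = integral {0..?b} weight_mean"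
    proof (rule Henstock_Kurzweil_Integration.integral_combine)
      show "weight_mean integrable_on {0..?b}"
        using ab by (intro integrable_continuous_interval continuous_on_subset[OF weight_mean_continuous]) auto
    qed (use ab in auto)
    then have i: "integral {?a..?b} weight_mean = integral {0..?b} weight_mean - integral {0..?a} weight_mean"
      by linarith
    have "D ?b - D ?a = angle lam ?b - angle lam ?a - 2 * \<mu> * integral {?a..?b} weight_mean"
      unfolding D_def i by (simp only: right_diff_distrib)
    ultimately show ?thesis unfolding \<mu>_def by simp
  qed
  have "D L = (\<Sum>i<M. D (real (Suc i) * d) - D (real i * d))"
    using sum_lessThan_telescope[of "\<lambda>i. D (real i * d)" M] d(2) angle_0[of lam] lam
    by (simp add: D_def)
  also have "\<bar>\<dots>\<bar> \<le> (\<Sum>i<M. 4 * pi + 2 * \<mu> * K * (\<bar>B\<bar> * d powr \<gamma>))"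
    using step by (intro order_trans[OF sum_abs] sum_mono) auto
  also have "\<dots> = 4 * pi * real M + 2 * K * \<bar>B\<bar> * (\<mu> * (real M * d powr \<gamma>))"
    by (simp add: algebra_simps)
  also have "\<dots> \<le> 4 * pi * (2 * N) + 2 * K * \<bar>B\<bar> * (L powr \<gamma> * N)"
  proof (intro add_mono mult_left_mono)
    have "real M * d powr \<gamma> = L powr \<gamma> * real M powr (1 - \<gamma>)"
      unfolding d_def using M_pos L_pos by (simp add: powr_divide powr_diff)
    also have "\<dots> \<le> L powr \<gamma> * N powr (1 - \<gamma>)"
      using M N \<gamma> by (intro mult_left_mono powr_mono2') auto
    finally have "\<mu> * (real M * d powr \<gamma>) \<le> \<mu> * (L powr \<gamma> * N powr (1 - \<gamma>))"
      using \<mu> by (intro mult_left_mono) auto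
    also have "\<dots> = L powr \<gamma> * (\<mu> powr 1 * \<mu> powr (1 / \<gamma> * (1 - \<gamma>)))"
      using \<mu> by (simp add: N_def powr_powr)
    also have "\<mu> powr 1 * \<mu> powr (1 / \<gamma> * (1 - \<gamma>)) = N"
      unfolding N_def powr_add[symmetric] using \<gamma> by (simp add: field_simps)
    finally show "\<mu> * (real M * d powr \<gamma>) \<le> L powr \<gamma> * N" .
  qed (use M K in auto)
  also have "\<dots> = (8 * pi + 2 * K * \<bar>B\<bar> * L powr \<gamma>) * N"
    by (simp add: algebra_simps)
  also have "N = lam powr (1 / \<gamma> / 2)"
    unfolding N_def \<mu>_def using lam by (simp add: powr_half_sqrt[symmetric] powr_powr mult.commute)
  finally show ?thesis by (simp add: D_def \<mu>_def K_def)
qed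

end

section \<open>Oscillation of the weights under the gamma condition\<close>

lemma harmonic_weight_eq:
  assumes "0 < m x" "0 < n x" "0 < s"
  shows "harmonic_weight m n s x = inverse (1 / sqrt (m x) + 1 / (sqrt s * sqrt (n x)))"
  using assms
  by (simp add: harmonic_weight_def powr_minus powr_half_sqrt real_sqrt_mult field_simps)

lemma abs_diff_le_inverse_sqrt:
  fixes u v C :: real
  assumes "0 < u" "u \<le> C" "0 < v" "v \<le> C"
  shows "\<bar>u - v\<bar> \<le> 2 * C * sqrt C * \<bar>1 / sqrt u - 1 / sqrt v\<bar>"
proof -
  have "u - v = (sqrt u)\<^sup>2 - (sqrt v)\<^sup>2" using assms by simp
  also have "\<dots> = (sqrt u + sqrt v) * (sqrt u - sqrt v)" by (simp add: power2_eq_square algebra_simps)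
  also have "\<dots> = - ((sqrt u + sqrt v) * (sqrt u * sqrt v)) * (1 / sqrt u - 1 / sqrt v)"
    using assms by (simp add: field_simps)
  finally have "\<bar>u - v\<bar> = (sqrt u + sqrt v) * (sqrt u * sqrt v) * \<bar>1 / sqrt u - 1 / sqrt v\<bar>"
    using assms by (simp add: abs_mult)
  also have "\<dots> \<le> (sqrt C + sqrt C) * (sqrt C * sqrt C) * \<bar>1 / sqrt u - 1 / sqrt v\<bar>"
    using assms by (intro mult_right_mono mult_mono add_mono) auto
  also have "\<dots> = 2 * C * sqrt C * \<bar>1 / sqrt u - 1 / sqrt v\<bar>"
    using assms by simp
  finally show ?thesis .
qed

lemma abs_inverse_diff_le:
  fixes u v h :: real
  assumes "0 < h" "h \<le> u" "h \<le> v"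
  shows "\<bar>inverse u - inverse v\<bar> \<le> \<bar>u - v\<bar> / h\<^sup>2"
proof -
  have uv: "0 < u" "0 < v" using assms by auto
  then have "\<bar>inverse u - inverse v\<bar> = \<bar>u - v\<bar> / (u * v)"
    by (simp add: inverse_eq_divide divide_diff_eq_iff[of 1] diff_frac_eq abs_mult abs_minus_commute)
  also have "\<dots> \<le> \<bar>u - v\<bar> / h\<^sup>2"
    using assms uv unfolding power2_eq_square by (intro divide_left_mono mult_mono) auto
  finally show ?thesis .
qed

text \<open>The point is a minimum of \<open>\<bar>f x - u\<bar> + \<bar>g x - v\<bar>\<close>. Replacing the constants \<open>u\<close>, \<open>v\<close> by the values
at this point then at most doubles the integrand, everywhere in the interval.\<close>

lemma common_mean_point:
  fixes f g :: "real \<Rightarrow> real"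
  assumes f: "continuous_on {a..b} f" and g: "continuous_on {a..b} g" and "a < b"
    and fA: "integral {a..b} (\<lambda>x. \<bar>f x - u\<bar>) \<le> A" and gB: "integral {a..b} (\<lambda>x. \<bar>g x - v\<bar>) \<le> B"
  shows "\<exists>\<xi>\<in>{a..b}. integral {a..b} (\<lambda>x. \<bar>f x - f \<xi>\<bar> + \<bar>g x - g \<xi>\<bar>) \<le> 2 * (A + B)"
proof -
  let ?h = "\<lambda>x. \<bar>f x - u\<bar> + \<bar>g x - v\<bar>"
  have hc: "continuous_on {a..b} ?h" by (intro continuous_intros f g)
  have hi: "?h integrable_on {a..b}" by (rule integrable_continuous_interval[OF hc])
  obtain \<xi> where \<xi>: "\<xi> \<in> {a..b}" "\<And>x. x \<in> {a..b} \<Longrightarrow> ?h \<xi> \<le> ?h x"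
    using continuous_attains_inf[OF _ _ hc] \<open>a < b\<close> by auto
  have "integral {a..b} ?h = integral {a..b} (\<lambda>x. \<bar>f x - u\<bar>) + integral {a..b} (\<lambda>x. \<bar>g x - v\<bar>)"
    by (intro integral_add integrable_continuous_interval continuous_intros f g)
  then have hAB: "integral {a..b} ?h \<le> A + B" using fA gB by linarith
  have "integral {a..b} (\<lambda>x. \<bar>f x - f \<xi>\<bar> + \<bar>g x - g \<xi>\<bar>) \<le> integral {a..b} (\<lambda>x. 2 * ?h x)"
  proof (rule integral_le)
    show "(\<lambda>x. \<bar>f x - f \<xi>\<bar> + \<bar>g x - g \<xi>\<bar>) integrable_on {a..b}"
      by (intro integrable_continuous_interval continuous_intros f g)
    show "(\<lambda>x. 2 * ?h x) integrable_on {a..b}"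
      by (intro integrable_continuous_interval continuous_intros hc)
    show "\<bar>f x - f \<xi>\<bar> + \<bar>g x - g \<xi>\<bar> \<le> 2 * ?h x" if "x \<in> {a..b}" for x
      using \<xi>(2)[OF that] abs_triangle_ineq4[of "f x - u" "f \<xi> - u"]
        abs_triangle_ineq4[of "g x - v" "g \<xi> - v"] by simp
  qed
  also have "\<dots> = 2 * integral {a..b} ?h" by (rule integral_mult_right)
  also have "\<dots> \<le> 2 * (A + B)" using hAB by (rule mult_left_mono) simp
  finally show ?thesis using \<xi>(1) by blast
qed

lemma gamma_condition_cong:
  assumes "gamma_condition \<gamma> L f" and eq: "\<And>x. x \<in> {0..L} \<Longrightarrow> f x = g x"
  shows "gamma_condition \<gamma> L g"
proof -
  obtain h1 h2 D where cont: "continuous_on {0..L} f"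
    and h: "0 < h1" "\<And>x. x \<in> {0..L} \<Longrightarrow> h1 \<le> f x \<and> f x \<le> h2"
    and D: "\<And>a b. a < b \<Longrightarrow> {a<..<b} \<subseteq> {0<..<L} \<Longrightarrow>
        integral {a<..<b} (\<lambda>x. \<bar>f x - average a b f\<bar>) \<le> D * (b - a) powr \<gamma>"
    using assms(1) unfolding gamma_condition_def by blast
  have "integral {a<..<b} (\<lambda>x. \<bar>g x - average a b g\<bar>) \<le> D * (b - a) powr \<gamma>"
    if "a < b" and sub: "{a<..<b} \<subseteq> {0<..<L}" for a b
  proof -
    have fg: "f x = g x" if "x \<in> {a<..<b}" for x
      using sub that by (intro eq) auto
    have "integral {a<..<b} f = integral {a<..<b} g" by (rule integral_cong[OF fg])
    then have "average a b f = average a b g" by (simp add: average_def)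
    then have "integral {a<..<b} (\<lambda>x. \<bar>f x - average a b f\<bar>) = integral {a<..<b} (\<lambda>x. \<bar>g x - average a b g\<bar>)"
      using fg by (intro integral_cong) auto
    then show ?thesis using D[OF that] by simp
  qed
  moreover have "continuous_on {0..L} g" using cont eq by (rule continuous_on_eq)
  moreover have "\<forall>x\<in>{0..L}. h1 \<le> g x \<and> g x \<le> h2" using h(2) eq by fastforce
  ultimately show ?thesis using h(1) unfolding gamma_condition_def by blast
qed

context weights
begin

text \<open>The two assumed functions \<open>f\<close> and \<open>g\<close> are the harmonic weights for \<open>t\<close> and \<open>4 t\<close> if \<open>q = t n\<close>. Their
reciprocals \<open>1 / sqrt p + 1 / sqrt q\<close> and \<open>1 / sqrt p + 1 / (2 sqrt q)\<close> determine \<open>p\<close> and \<open>q\<close> by smooth formulas,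
so the oscillation of the weights is bounded pointwise by that of \<open>f\<close> and \<open>g\<close>.\<close>

lemma mean_oscillation_bound_from_gamma_condition:
  assumes g1: "gamma_condition \<gamma> L (\<lambda>x. inverse (1 / sqrt (p x) + 1 / sqrt (q x)))"
    and g4: "gamma_condition \<gamma> L (\<lambda>x. inverse (1 / sqrt (p x) + 1 / (2 * sqrt (q x))))"
  shows "\<exists>B. mean_oscillation_bound B \<gamma>"
proof -
  define f where "f = weight_mean"
  define g where "g x = inverse (1 / sqrt (p x) + 1 / (2 * sqrt (q x)))" for x
  have gf: "gamma_condition \<gamma> L f" using g1 by (simp add: f_def weight_mean_def[abs_def])
  have gg: "gamma_condition \<gamma> L g" using g4 by (simp add: g_def[abs_def])
  have fc: "continuous_on {0..L} f" using gf by (simp add: gamma_condition_def)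
  have gc: "continuous_on {0..L} g" using gg by (simp add: gamma_condition_def)
  obtain hf where hf: "0 < hf" "\<And>x. x \<in> {0..L} \<Longrightarrow> hf \<le> f x"
    using gf unfolding gamma_condition_def by blast
  obtain hg where hg: "0 < hg" "\<And>x. x \<in> {0..L} \<Longrightarrow> hg \<le> g x"
    using gg unfolding gamma_condition_def by blast
  define h where "h = min hf hg"
  have h: "0 < h" "\<And>x. x \<in> {0..L} \<Longrightarrow> h \<le> f x" "\<And>x. x \<in> {0..L} \<Longrightarrow> h \<le> g x"
    using hf hg by (auto simp: h_def min.coboundedI1 min.coboundedI2)
  obtain Cf where Cf: "\<And>a b. a < b \<Longrightarrow> {a<..<b} \<subseteq> {0<..<L} \<Longrightarrow>
        integral {a<..<b} (\<lambda>x. \<bar>f x - average a b f\<bar>) \<le> Cf * (b - a) powr \<gamma>"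
    using gf unfolding gamma_condition_def by blast
  obtain Cg where Cg: "\<And>a b. a < b \<Longrightarrow> {a<..<b} \<subseteq> {0<..<L} \<Longrightarrow>
        integral {a<..<b} (\<lambda>x. \<bar>g x - average a b g\<bar>) \<le> Cg * (b - a) powr \<gamma>"
    using gg unfolding gamma_condition_def by blast
  define K where "K = 1 + 2 * C * sqrt C * (7 / h\<^sup>2)"
  have K: "0 \<le> K" using C_pos by (simp add: K_def)
  have osc: "weight_oscillation \<xi> x + \<bar>weight_mean x - weight_mean \<xi>\<bar> \<le> K * (\<bar>f x - f \<xi>\<bar> + \<bar>g x - g \<xi>\<bar>)"
    if "x \<in> {0..L}" "\<xi> \<in> {0..L}" for x \<xi>
  proof -
    let ?F = "\<bar>f x - f \<xi>\<bar> / h\<^sup>2" and ?G = "\<bar>g x - g \<xi>\<bar> / h\<^sup>2"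
    have P: "1 / sqrt (p z) = 2 * inverse (g z) - inverse (f z)"
      and Q: "1 / sqrt (q z) = 2 * inverse (f z) - 2 * inverse (g z)" for z
      by (simp_all add: f_def g_def weight_mean_def)
    have dF: "\<bar>inverse (f x) - inverse (f \<xi>)\<bar> \<le> ?F" and dG: "\<bar>inverse (g x) - inverse (g \<xi>)\<bar> \<le> ?G"
      using that h by (auto intro: abs_inverse_diff_le)
    have pq: "0 < p z" "p z \<le> C" "0 < q z" "q z \<le> C" if "z \<in> {0..L}" for z
      using p_bounds[OF that] q_bounds[OF that] c_pos by auto
    have "\<bar>p x - p \<xi>\<bar> \<le> 2 * C * sqrt C * \<bar>1 / sqrt (p x) - 1 / sqrt (p \<xi>)\<bar>"
      using pq that by (intro abs_diff_le_inverse_sqrt) auto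
    also have "\<dots> \<le> 2 * C * sqrt C * (2 * ?G + ?F)"
      unfolding P using dF dG C_pos by (intro mult_left_mono) (linarith | simp)+
    finally have p: "\<bar>p x - p \<xi>\<bar> \<le> 2 * C * sqrt C * (2 * ?G + ?F)" .
    have "\<bar>q x - q \<xi>\<bar> \<le> 2 * C * sqrt C * \<bar>1 / sqrt (q x) - 1 / sqrt (q \<xi>)\<bar>"
      using pq that by (intro abs_diff_le_inverse_sqrt) auto
    also have "\<dots> \<le> 2 * C * sqrt C * (2 * ?F + 2 * ?G)"
      unfolding Q using dF dG C_pos by (intro mult_left_mono) (linarith | simp)+
    finally have "weight_oscillation \<xi> x \<le> 2 * C * sqrt C * (2 * ?G + ?F) + 2 * C * sqrt C * (2 * ?F + 2 * ?G)"
      using p unfolding weight_oscillation_def by linarith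
    also have "\<dots> = 2 * C * sqrt C * (3 * ?F + 4 * ?G)" by (simp add: algebra_simps)
    also have "\<dots> \<le> 2 * C * sqrt C * (7 * ?F + 7 * ?G)"
      using C_pos by (intro mult_left_mono add_mono mult_right_mono) auto
    also have "\<dots> = 2 * C * sqrt C * (7 / h\<^sup>2) * (\<bar>f x - f \<xi>\<bar> + \<bar>g x - g \<xi>\<bar>)"
      by (simp add: algebra_simps add_divide_distrib)
    finally show ?thesis unfolding K_def f_def[symmetric] distrib_right by simp
  qed
  have "\<exists>\<xi>\<in>{a..b}. integral {a..b} (\<lambda>x. weight_oscillation \<xi> x + \<bar>weight_mean x - weight_mean \<xi>\<bar>)
      \<le> K * (2 * (Cf + Cg)) * (b - a) powr \<gamma>" if ab: "0 \<le> a" "a < b" "b \<le> L" for a b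
  proof -
    have sub: "{a..b} \<subseteq> {0..L}" and sub': "{a<..<b} \<subseteq> {0<..<L}" using ab by auto
    note fc' = continuous_on_subset[OF fc sub] and gc' = continuous_on_subset[OF gc sub]
    obtain \<xi> where \<xi>: "\<xi> \<in> {a..b}" "integral {a..b} (\<lambda>x. \<bar>f x - f \<xi>\<bar> + \<bar>g x - g \<xi>\<bar>)
        \<le> 2 * (Cf * (b - a) powr \<gamma> + Cg * (b - a) powr \<gamma>)"
      using common_mean_point[OF fc' gc' ab(2)] Cf[OF ab(2) sub'] Cg[OF ab(2) sub']
      unfolding integral_open_interval_real[symmetric] by blast
    have "integral {a..b} (\<lambda>x. weight_oscillation \<xi> x + \<bar>weight_mean x - weight_mean \<xi>\<bar>)
        \<le> integral {a..b} (\<lambda>x. K * (\<bar>f x - f \<xi>\<bar> + \<bar>g x - g \<xi>\<bar>))"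
    proof (rule integral_le)
      show "(\<lambda>x. weight_oscillation \<xi> x + \<bar>weight_mean x - weight_mean \<xi>\<bar>) integrable_on {a..b}"
        by (intro integrable_continuous_interval continuous_intros
            continuous_on_subset[OF weight_oscillation_continuous sub]
            continuous_on_subset[OF weight_mean_continuous sub])
      show "(\<lambda>x. K * (\<bar>f x - f \<xi>\<bar> + \<bar>g x - g \<xi>\<bar>)) integrable_on {a..b}"
        by (intro integrable_continuous_interval continuous_intros fc' gc')
    qed (use osc sub \<xi>(1) in blast)
    also have "\<dots> = K * integral {a..b} (\<lambda>x. \<bar>f x - f \<xi>\<bar> + \<bar>g x - g \<xi>\<bar>)"
      by (rule integral_mult_right)
    also have "\<dots> \<le> K * (2 * (Cf * (b - a) powr \<gamma> + Cg * (b - a) powr \<gamma>))"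
      using \<xi>(2) K by (rule mult_left_mono)
    also have "\<dots> = K * (2 * (Cf + Cg)) * (b - a) powr \<gamma>" by (simp only: distrib_right mult.assoc)
    finally show ?thesis using \<xi>(1) by (rule bexI)
  qed
  then show ?thesis unfolding mean_oscillation_bound_def by blast
qed

lemma card_eigenvalue_plus_asymptotics:
  assumes "mean_oscillation_bound B \<gamma>" "1 < \<gamma>"
  shows "\<exists>K. \<forall>lam\<ge>1. \<bar>real (card {k. k \<ge> 1 \<and> eigenvalue_plus p q 1 L k \<le> lam})
      - 2 * sqrt lam / pi * integral {0..L} weight_mean\<bar> \<le> K * lam powr (1 / \<gamma> / 2)"
proof (intro exI allI impI)
  fix lam :: real assume lam: "1 \<le> lam"
  define A where "A = 8 * pi + 2 * (sqrt C / c + 1) * \<bar>B\<bar> * L powr \<gamma>"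
  define R where "R = lam powr (1 / \<gamma> / 2)"
  have "\<bar>angle lam L - 2 * sqrt lam * integral {0..L} weight_mean\<bar> / pi \<le> A * R / pi"
    unfolding A_def R_def using angle_asymptotics[OF assms lam] by (intro divide_right_mono) auto
  then have "\<bar>angle lam L / pi - 2 * sqrt lam / pi * integral {0..L} weight_mean\<bar> \<le> A / pi * R"
    by (simp add: abs_divide[of _ pi, symmetric, unfolded abs_of_pos[OF pi_gt_zero]] diff_divide_distrib)
  moreover have "1 \<le> R"
    unfolding R_def using lam assms(2) by (intro ge_one_powr_ge_zero) auto
  moreover have "\<bar>real (card {k. k \<ge> 1 \<and> eigenvalue_plus p q 1 L k \<le> lam}) - angle lam L / pi\<bar> \<le> 1"
    using lam by (intro card_eigenvalue_plus_le) simp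
  ultimately have "\<bar>real (card {k. k \<ge> 1 \<and> eigenvalue_plus p q 1 L k \<le> lam})
      - 2 * sqrt lam / pi * integral {0..L} weight_mean\<bar> \<le> R + A / pi * R"
    by linarith
  then show "\<bar>real (card {k. k \<ge> 1 \<and> eigenvalue_plus p q 1 L k \<le> lam})
      - 2 * sqrt lam / pi * integral {0..L} weight_mean\<bar> \<le> (1 + (8 * pi + 2 * (sqrt C / c + 1) * \<bar>B\<bar> * L powr \<gamma>) / pi) * lam powr (1 / \<gamma> / 2)"
    unfolding A_def R_def by (simp add: algebra_simps)
qed

end

section \<open>The two sequences of eigenvalues\<close>

lemma eigenvalue_plus_absorb:
  "eigenvalue_plus m n t L k = eigenvalue_plus m (\<lambda>x. t * n x) 1 L k"
  by (simp add: eigenvalue_plus_def solves_problem_def)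

lemma solves_problem_uminus:
  "solves_problem m n t L lam u u' \<longleftrightarrow>
    solves_problem (\<lambda>x. t * n x) m 1 L lam (\<lambda>x. - u x) (\<lambda>x. - u' x)"
proof -
  have minus: "((\<lambda>x. - f x) has_real_derivative - d) (at x within S) \<longleftrightarrow> (f has_real_derivative d) (at x within S)"
    for f :: "real \<Rightarrow> real" and d x S
    using DERIV_minus[of f d x S] DERIV_minus[of "\<lambda>x. - f x" "- d" x S] by auto
  have "continuous_on {0..L} (\<lambda>x. - u' x) \<longleftrightarrow> continuous_on {0..L} u'"
    using continuous_on_minus[of "{0..L}" u'] continuous_on_minus[of "{0..L}" "\<lambda>x. - u' x"] by auto
  moreover have "((\<lambda>x. - u' x) has_real_derivative
        - (lam * (t * n x * pos_part (\<lambda>x. - u x) x - 1 * m x * neg_part (\<lambda>x. - u x) x))) (at x) \<longleftrightarrow>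
      (u' has_real_derivative - (lam * (m x * pos_part u x - t * n x * neg_part u x))) (at x)" for x
    unfolding minus[symmetric, of u']
    by (simp add: pos_part_def neg_part_def algebra_simps)
  ultimately show ?thesis unfolding solves_problem_def minus by simp
qed

text \<open>The positive part of \<open>-u\<close> is the negative part of \<open>u\<close>, so passing to \<open>-u\<close> exchanges the weights and the sign of
\<open>u' 0\<close> and keeps the nodal domains.\<close>

lemma eigenvalue_minus_swap:
  "eigenvalue_minus m n t L k = eigenvalue_plus (\<lambda>x. t * n x) m 1 L k"
proof -
  let ?P = "\<lambda>lam u u'. solves_problem (\<lambda>x. t * n x) m 1 L lam u u' \<and> (\<exists>x\<in>{0..L}. u x \<noteq> 0) \<and>
      card (nodal_domains L u) = k \<and> 0 < u' 0"
  have "(\<exists>u u'. solves_problem m n t L lam u u' \<and> (\<exists>x\<in>{0..L}. u x \<noteq> 0) \<and>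
      card (nodal_domains L u) = k \<and> u' 0 < 0) \<longleftrightarrow> (\<exists>u u'. ?P lam u u')" for lam
  proof -
    have "(\<exists>u u'. solves_problem m n t L lam u u' \<and> (\<exists>x\<in>{0..L}. u x \<noteq> 0) \<and>
      card (nodal_domains L u) = k \<and> u' 0 < 0) \<longleftrightarrow> (\<exists>u u'. ?P lam (\<lambda>x. - u x) (\<lambda>x. - u' x))"
      unfolding solves_problem_uminus[of m n] by (simp add: nodal_domains_def)
    also have "\<dots> \<longleftrightarrow> (\<exists>u u'. ?P lam u u')"
    proof
      assume "\<exists>u u'. ?P lam u u'"
      then obtain u u' where "?P lam u u'" by blast
      then show "\<exists>u u'. ?P lam (\<lambda>x. - u x) (\<lambda>x. - u' x)"
        by (intro exI[of _ "\<lambda>x. - u x"] exI[of _ "\<lambda>x. - u' x"]) simp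
    qed blast
    finally show ?thesis .
  qed
  then show ?thesis unfolding eigenvalue_minus_def eigenvalue_plus_def by simp
qed

theorem theorem1p7:
  fixes m n :: "real \<Rightarrow> real" and L \<gamma> t \<delta> :: real
  assumes "L > 0"
    and "continuous_on {0..L} m" and "continuous_on {0..L} n"
    and "\<exists>c>0. \<forall>x\<in>{0..L}. c \<le> m x" and "\<exists>c>0. \<forall>x\<in>{0..L}. c \<le> n x"
    and "\<gamma> > 1"
    and "\<forall>s>0. gamma_condition \<gamma> L (harmonic_weight m n s)"
    and "t > 0"
    and "\<delta> \<in> {1 / \<gamma>..1}"
  shows "(\<lambda>lam. real (counting_function m n lam t L)
            - 4 * sqrt lam / pi * integral {0..L} (harmonic_weight m n t))
         \<in> O[at_top](\<lambda>lam. lam powr (\<delta> / 2))"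
proof -
  define r where "r x = t * n x" for x
  obtain cm cn where cm: "0 < cm" "\<And>x. x \<in> {0..L} \<Longrightarrow> cm \<le> m x"
    and cn: "0 < cn" "\<And>x. x \<in> {0..L} \<Longrightarrow> cn \<le> n x"
    using assms(4,5) by blast
  define c where "c = min cm (t * cn)"
  have c: "0 < c" using cm cn \<open>t > 0\<close> by (simp add: c_def)
  have lower: "c \<le> m x" "c \<le> r x" if "x \<in> {0..L}" for x
  proof -
    have "t * cn \<le> r x" unfolding r_def using cn(2)[OF that] \<open>t > 0\<close> by (intro mult_left_mono) auto
    then show "c \<le> m x" "c \<le> r x" using cm(2)[OF that] by (auto simp: c_def)
  qed
  have r_cont: "continuous_on {0..L} r" unfolding r_def by (intro continuous_intros assms(3))
  have "compact ((\<lambda>x. max (m x) (r x)) ` {0..L})"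
    by (intro compact_continuous_image continuous_intros assms(2) r_cont) auto
  then have "bdd_above ((\<lambda>x. max (m x) (r x)) ` {0..L})"
    by (intro bounded_imp_bdd_above compact_imp_bounded)
  then obtain C where C: "\<And>x. x \<in> {0..L} \<Longrightarrow> max (m x) (r x) \<le> C"
    by (auto simp only: bdd_above_def ball_simps)
  have upper: "m x \<le> C" "r x \<le> C" if "x \<in> {0..L}" for x
    using C[OF that] by auto
  interpret plus: weights L c C m r
    by unfold_locales (use assms(1-3) c lower upper r_cont in auto)
  interpret minus: weights L c C r m
    by unfold_locales (use assms(1-3) c lower upper r_cont in auto)
  have mn: "0 < m x" "0 < n x" if "x \<in> {0..L}" for x
    using cm cn that by (auto intro: less_le_trans)
  have swap: "minus.weight_mean = plus.weight_mean"
    unfolding minus.weight_mean_def[abs_def] plus.weight_mean_def[abs_def] by (simp add: add.commute)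
  have swap_oscillation: "minus.weight_oscillation = plus.weight_oscillation"
    by (intro ext) (simp only: minus.weight_oscillation_def plus.weight_oscillation_def add.commute)
  have harmonic: "harmonic_weight m n t x = plus.weight_mean x" if "x \<in> {0..L}" for x
    using mn[OF that] \<open>t > 0\<close> by (simp add: harmonic_weight_eq plus.weight_mean_def r_def real_sqrt_mult)
  \<comment> \<open>Quadrupling \<open>t\<close> halves the second term, which gives an independent linear combination.\<close>
  have harmonic4: "harmonic_weight m n (4 * t) x = inverse (1 / sqrt (m x) + 1 / (2 * sqrt (r x)))"
    if "x \<in> {0..L}" for x
    using mn[OF that] \<open>t > 0\<close> by (simp add: harmonic_weight_eq r_def real_sqrt_mult)
  have "gamma_condition \<gamma> L (\<lambda>x. inverse (1 / sqrt (m x) + 1 / sqrt (r x)))"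
    by (rule gamma_condition_cong[OF assms(7)[rule_format, OF \<open>t > 0\<close>]])
       (rule harmonic[unfolded plus.weight_mean_def])
  moreover have "gamma_condition \<gamma> L (\<lambda>x. inverse (1 / sqrt (m x) + 1 / (2 * sqrt (r x))))"
    by (rule gamma_condition_cong[OF assms(7)[rule_format, of "4 * t"] harmonic4])
       (use \<open>t > 0\<close> in simp_all)
  ultimately obtain B where B: "plus.mean_oscillation_bound B \<gamma>"
    using plus.mean_oscillation_bound_from_gamma_condition by blast
  then have "minus.mean_oscillation_bound B \<gamma>"
    unfolding minus.mean_oscillation_bound_def plus.mean_oscillation_bound_def swap
      swap_oscillation .
  note minus_asymptotics = minus.card_eigenvalue_plus_asymptotics[OF this assms(6), unfolded swap]
  obtain K2 where K2: "\<forall>lam\<ge>1. \<bar>real (card {k. k \<ge> 1 \<and> eigenvalue_plus r m 1 L k \<le> lam})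
      - 2 * sqrt lam / pi * integral {0..L} plus.weight_mean\<bar> \<le> K2 * lam powr (1 / \<gamma> / 2)"
    using minus_asymptotics by (rule exE)
  obtain K1 where K1: "\<forall>lam\<ge>1. \<bar>real (card {k. k \<ge> 1 \<and> eigenvalue_plus m r 1 L k \<le> lam})
      - 2 * sqrt lam / pi * integral {0..L} plus.weight_mean\<bar> \<le> K1 * lam powr (1 / \<gamma> / 2)"
    using plus.card_eigenvalue_plus_asymptotics[OF B assms(6)] by (rule exE)
  have I: "integral {0..L} (harmonic_weight m n t) = integral {0..L} plus.weight_mean"
    by (rule integral_cong) (rule harmonic)
  have N: "real (counting_function m n lam t L) = real (card {k. k \<ge> 1 \<and> eigenvalue_plus m r 1 L k \<le> lam})
      + real (card {k. k \<ge> 1 \<and> eigenvalue_plus r m 1 L k \<le> lam})" for lam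
    unfolding counting_function_def eigenvalue_plus_absorb[of m n t] eigenvalue_minus_swap[of m n t] r_def
    by simp
  have bound: "\<bar>real (counting_function m n lam t L)
      - 4 * sqrt lam / pi * integral {0..L} (harmonic_weight m n t)\<bar> \<le> \<bar>K1 + K2\<bar> * lam powr (\<delta> / 2)"
    if lam: "1 \<le> lam" for lam
  proof -
    have "\<bar>real (counting_function m n lam t L)
        - 4 * sqrt lam / pi * integral {0..L} (harmonic_weight m n t)\<bar>
        \<le> K1 * lam powr (1 / \<gamma> / 2) + K2 * lam powr (1 / \<gamma> / 2)"
      using K1[rule_format, OF lam] K2[rule_format, OF lam] unfolding N I by linarith
    also have "\<dots> = (K1 + K2) * lam powr (1 / \<gamma> / 2)" by (simp add: algebra_simps)
    also have "\<dots> \<le> \<bar>K1 + K2\<bar> * lam powr (\<delta> / 2)"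
      using lam assms(9) by (intro mult_mono powr_mono) auto
    finally show ?thesis .
  qed
  show ?thesis
  proof (rule bigoI[where c = "\<bar>K1 + K2\<bar>"])
    show "\<forall>\<^sub>F lam in at_top. norm (real (counting_function m n lam t L)
        - 4 * sqrt lam / pi * integral {0..L} (harmonic_weight m n t))
        \<le> \<bar>K1 + K2\<bar> * norm (lam powr (\<delta> / 2))"
      using eventually_ge_at_top[of 1]
    proof eventually_elim
      case (elim lam)
      have "norm (lam powr (\<delta> / 2)) = lam powr (\<delta> / 2)" by simp
      then show ?case unfolding real_norm_def using bound[OF elim] by simp
    qed
  qed
qed

end
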